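(* Let $1\le l<k\le n$. For any $\epsilon,\delta,\delta_0\in(0,1)$ there exists a constant $\delta'>0$ depending only on $\epsilon,\delta,\delta_0,n,k$ and $l$ such that the following holds. Let $\lambda=(\lambda_1,\dots,\lambda_n)\in\Gamma_k$ with $\lambda_1\ge\cdots\ge\lambda_n$. If $\lambda_l\ge\delta\lambda_1$ and $\lambda_{l+1}\le\delta'\lambda_1$, then for every vector $\xi=(\xi_1,\dots,\xi_n)\in\mathbb{R}^n$, $$-\sum_{p\neq q}\frac{\sigma_k^{pp,qq}\,\xi_p\xi_q}{\sigma_k}+\frac{\left(\sum_i\sigma_k^{ii}\xi_i\right)^2}{\sigma_k^2}\ \ge\ (1-\epsilon)\frac{\xi_1^2}{\lambda_1^2}-\delta_0\sum_{i>l}\frac{\sigma_k^{ii}\,\xi_i^2}{\lambda_1\sigma_k},$$ where $\sigma_k$, $\sigma_k^{ii}$ and $\sigma_k^{pp,qq}$ are evaluated at $\lambda$.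
   Context: $\sigma_j$ is the $j$-th elementary symmetric function of $n$ variables, and $\Gamma_k=\{\lambda\in\mathbb{R}^n:\sigma_j(\lambda)>0,\ 1\le j\le k\}$. For $\lambda\in\mathbb{R}^n$, $\sigma_k^{ii}=\frac{\partial\sigma_k}{\partial\lambda_i}(\lambda)$, and for $p\ne q$, $\sigma_k^{pp,qq}=\frac{\partial^2\sigma_k}{\partial\lambda_p\partial\lambda_q}(\lambda)$. Sums over $i,p,q$ run over $\{1,\dots,n\}$ subject to the indicated restrictions. *)

theory Defs
  imports "HOL-Analysis.Analysis"
begin

text \<open>
  A point of \<open>\<real>\<^sup>n\<close> is represented by a function \<open>nat \<Rightarrow> real\<close> of which only the values at the
  indices \<open>1, \<dots>, n\<close> are used, so that the dimension \<open>n\<close> can be quantified inside a statement.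
\<close>

definition esym :: "nat \<Rightarrow> nat \<Rightarrow> (nat \<Rightarrow> real) \<Rightarrow> real" where
  "esym n j x = (\<Sum>S | S \<subseteq> {1..n} \<and> card S = j. \<Prod>i\<in>S. x i)"

definition garding_cone :: "nat \<Rightarrow> nat \<Rightarrow> (nat \<Rightarrow> real) set" where
  "garding_cone n k = {x. \<forall>j\<in>{1..k}. esym n j x > 0}"

definition pderivative :: "nat \<Rightarrow> ((nat \<Rightarrow> real) \<Rightarrow> real) \<Rightarrow> (nat \<Rightarrow> real) \<Rightarrow> real" where
  "pderivative i f x = deriv (\<lambda>t. f (x(i := t))) (x i)"

definition esym_d1 :: "nat \<Rightarrow> nat \<Rightarrow> nat \<Rightarrow> (nat \<Rightarrow> real) \<Rightarrow> real" where
  "esym_d1 n k i = pderivative i (esym n k)"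

definition esym_d2 :: "nat \<Rightarrow> nat \<Rightarrow> nat \<Rightarrow> nat \<Rightarrow> (nat \<Rightarrow> real) \<Rightarrow> real" where
  "esym_d2 n k p q = pderivative p (pderivative q (esym n k))"

end

theory Submission
  imports Defs
begin

text \<open>
  The left-hand side of the inequality is \<open>- D\<^sup>2 ln \<sigma>\<^sub>k\<close> in the direction \<open>\<xi>\<close>. When \<open>\<lambda>\<^sub>1, \<dots>, \<lambda>\<^sub>l\<close>
  are comparable and the other entries are much smaller, \<open>\<sigma>\<^sub>l\<close> is close to \<open>\<lambda>\<^sub>1 \<cdots> \<lambda>\<^sub>l\<close>, and
  \<open>- D\<^sup>2 ln (\<lambda>\<^sub>1 \<cdots> \<lambda>\<^sub>l)\<close> is \<open>\<Sum>\<^sub>i\<^sub>\<le>\<^sub>l \<xi>\<^sub>i\<^sup>2 / \<lambda>\<^sub>i\<^sup>2\<close>, which contains the wanted term. So the proof passes from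
  \<open>\<sigma>\<^sub>k\<close> to \<open>\<sigma>\<^sub>l\<close> and then estimates the Hessian of \<open>ln \<sigma>\<^sub>l\<close> directly.

  The passage rests on the concavity of the quotients \<open>q\<^sub>j = \<sigma>\<^sub>j\<^sub>+\<^sub>1 / \<sigma>\<^sub>j\<close> on \<open>\<Gamma>\<^sub>j\<close>. It follows by
  induction on \<open>j\<close>, for \<open>j \<ge> 1\<close> from the identity \<open>(j + 1) q\<^sub>j = \<Sum>\<^sub>i (\<lambda>\<^sub>i - \<lambda>\<^sub>i\<^sup>2 / (\<lambda>\<^sub>i + q\<^sub>j\<^sub>-\<^sub>1(\<lambda>|i)))\<close>, where \<open>\<lambda>|i\<close>
  omits the \<open>i\<close>-th entry, because \<open>a\<^sup>2 / b\<close> is jointly convex and decreasing in \<open>b > 0\<close>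
  (\<open>esym_quot_rec\<close>, \<open>esym_quot_superadditive\<close>). The same identity shows that \<open>q\<^sub>j\<close> is nondecreasing
  in each variable; this yields Newton's inequality for \<open>\<lambda>|i\<close>, and hence \<open>\<lambda>|i \<in> \<Gamma>\<^sub>j\<^sub>-\<^sub>1\<close> for \<open>\<lambda> \<in> \<Gamma>\<^sub>j\<close>
  (\<open>in_cone_remove_and_esym_quot_mono\<close>). As \<open>ln (\<sigma>\<^sub>k / \<sigma>\<^sub>l)\<close> is a sum of logarithms of positive concave
  functions, \<open>- D\<^sup>2 ln \<sigma>\<^sub>k \<ge> - D\<^sup>2 ln \<sigma>\<^sub>l\<close> on \<open>\<Gamma>\<^sub>k\<close> (\<open>ln_esym_on_Hessian_mono\<close>).

  The coefficients of the quadratic form \<open>- \<sigma>\<^sub>l\<^sup>2 D\<^sup>2 ln \<sigma>\<^sub>l\<close> are \<open>\<sigma>\<^sub>l\<^sub>-\<^sub>1(\<lambda>|p)\<^sup>2\<close> on the diagonal and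
  \<open>\<sigma>\<^sub>l\<^sub>-\<^sub>1(\<lambda>|pq)\<^sup>2 - \<sigma>\<^sub>l(\<lambda>|pq) \<sigma>\<^sub>l\<^sub>-\<^sub>2(\<lambda>|pq)\<close> off it. For \<open>p, q \<le> l\<close> every monomial of \<open>\<sigma>\<^sub>l\<^sub>-\<^sub>1(\<lambda>|pq)\<close> and
  \<open>\<sigma>\<^sub>l(\<lambda>|pq)\<close> contains a small entry, so these off-diagonal coefficients are negligible. The other
  off-diagonal ones are bounded after scaling, and Young's inequality moves them into the coefficient of the tail
  \<open>\<Sum>\<^sub>i\<^sub>>\<^sub>l \<xi>\<^sub>i\<^sup>2 / \<lambda>\<^sub>1\<^sup>2\<close> (\<open>ln_esym_on_Hessian_lower_bound\<close>). The tail is paid for by the last sum of the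
  theorem: \<open>\<sigma>\<^sub>k \<le> n \<lambda>\<^sub>l\<^sub>+\<^sub>1 \<sigma>\<^sub>k\<^sup>i\<^sup>i\<close> for \<open>i > l\<close> (\<open>esym_le_tail_mult_minor\<close>), so that
  \<open>\<sigma>\<^sub>k\<^sup>i\<^sup>i / (\<lambda>\<^sub>1 \<sigma>\<^sub>k)\<close> is at least \<open>1 / (n \<delta>' \<lambda>\<^sub>1\<^sup>2)\<close>, which is as large a multiple of \<open>1 / \<lambda>\<^sub>1\<^sup>2\<close> as
  desired once \<open>\<delta>'\<close> is small.
\<close>

section \<open>Elementary symmetric functions over an index set\<close>

text \<open>
  The inductions on the degree delete variables, so the index set is a parameter.
\<close>
definition esym_on :: "'a set \<Rightarrow> nat \<Rightarrow> ('a \<Rightarrow> real) \<Rightarrow> real" where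
  "esym_on A j x = (\<Sum>S | S \<subseteq> A \<and> card S = j. \<Prod>i\<in>S. x i)"

lemma esym_eq_esym_on: "esym n j = esym_on {1..n} j"
  by (simp add: fun_eq_iff esym_def esym_on_def)

lemma esym_on_0 [simp]:
  assumes "finite A"
  shows "esym_on A 0 x = 1"
proof -
  have "{S. S \<subseteq> A \<and> card S = 0} = {{}}"
    using assms by (auto simp: finite_subset)
  then show ?thesis by (simp add: esym_on_def)
qed

lemma esym_on_empty_Suc [simp]: "esym_on {} (Suc j) x = 0"
proof -
  have "{S :: 'a set. S \<subseteq> {} \<and> card S = Suc j} = {}"
    by auto
  then show ?thesis by (simp add: esym_on_def)
qed

lemma esym_on_insert:
  assumes "finite A" "a \<notin> A"
  shows "esym_on (insert a A) (Suc j) x = x a * esym_on A j x + esym_on A (Suc j) x"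
proof -
  \<comment> \<open>The \<open>j + 1\<close>-element subsets are sorted by whether they contain \<open>a\<close>.\<close>
  let ?with = "insert a ` {S. S \<subseteq> A \<and> card S = j}"
  let ?without = "{S. S \<subseteq> A \<and> card S = Suc j}"
  have split: "{S. S \<subseteq> insert a A \<and> card S = Suc j} = ?with \<union> ?without"
  proof (intro equalityI subsetI)
    fix S assume S: "S \<in> {S. S \<subseteq> insert a A \<and> card S = Suc j}"
    show "S \<in> ?with \<union> ?without"
    proof (cases "a \<in> S")
      case True
      then have "S = insert a (S - {a})" "S - {a} \<subseteq> A" "card (S - {a}) = j"
        using S by (auto simp: card_Diff_singleton)
      then show ?thesis by blast
    qed (use S in auto)
  next
    fix S assume "S \<in> ?with \<union> ?without"
    moreover have "card (insert a T) = Suc (card T)" if "T \<subseteq> A" for T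
      using that assms by (intro card_insert_disjoint) (auto intro: finite_subset)
    ultimately show "S \<in> {S. S \<subseteq> insert a A \<and> card S = Suc j}"
      by auto
  qed
  have inj: "inj_on (insert a) {S. S \<subseteq> A \<and> card S = j}"
    using assms(2) by (intro inj_onI) (metis (no_types, lifting) Diff_insert_absorb mem_Collect_eq subsetD)
  have "esym_on (insert a A) (Suc j) x
      = (\<Sum>S\<in>?with. \<Prod>i\<in>S. x i) + (\<Sum>S\<in>?without. \<Prod>i\<in>S. x i)"
    unfolding esym_on_def split using assms by (intro sum.union_disjoint) auto
  also have "(\<Sum>S\<in>?with. \<Prod>i\<in>S. x i)
      = (\<Sum>S | S \<subseteq> A \<and> card S = j. \<Prod>i\<in>insert a S. x i)"
    by (simp add: sum.reindex[OF inj])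
  also have "\<dots> = (\<Sum>S | S \<subseteq> A \<and> card S = j. x a * (\<Prod>i\<in>S. x i))"
    using assms by (intro sum.cong refl prod.insert) (auto intro: finite_subset)
  also have "\<dots> = x a * esym_on A j x"
    by (simp add: esym_on_def sum_distrib_left)
  finally show ?thesis by (simp add: esym_on_def)
qed

lemma esym_on_remove:
  assumes "finite A" "a \<in> A"
  shows "esym_on A (Suc j) x = x a * esym_on (A - {a}) j x + esym_on (A - {a}) (Suc j) x"
  using esym_on_insert[of "A - {a}" a j x] assms by (simp add: insert_absorb)

lemma esym_on_cong:
  assumes "\<And>i. i \<in> A \<Longrightarrow> x i = y i"
  shows "esym_on A j x = esym_on A j y"
  unfolding esym_on_def using assms by (intro sum.cong refl prod.cong) auto

lemma esym_on_fun_upd: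
  "i \<notin> A \<Longrightarrow> esym_on A j (x(i := t)) = esym_on A j x"
  by (rule esym_on_cong) auto

lemma esym_on_scale: "esym_on A j (\<lambda>i. c * x i) = c ^ j * esym_on A j x"
  by (auto simp: esym_on_def sum_distrib_left prod.distrib intro!: sum.cong)

lemma esym_on_1:
  assumes "finite A"
  shows "esym_on A (Suc 0) x = sum x A"
  using assms
proof induction
  case (insert a A)
  then show ?case by (simp add: esym_on_insert)
qed simp

text \<open>
  Euler's identity for a homogeneous function of degree \<open>j + 1\<close>, since \<open>esym_on (A - {i}) j x\<close> is the
  partial derivative of \<open>esym_on A (Suc j)\<close> in direction \<open>i\<close>.
\<close>
lemma sum_mult_esym_on_remove:
  assumes "finite A"
  shows "(\<Sum>i\<in>A. x i * esym_on (A - {i}) j x) = (real j + 1) * esym_on A (Suc j) x"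
  using assms
proof (induction arbitrary: j)
  case empty
  then show ?case by simp
next
  case (insert a A)
  have del: "insert a A - {i} = insert a (A - {i})" if "i \<in> A" for i
    using that insert.hyps by auto
  have aA: "insert a A - {a} = A" using insert.hyps by auto
  show ?case
  proof (cases j)
    case 0
    then show ?thesis
      using insert.hyps by (simp add: esym_on_1)
  next
    case (Suc m)
    have "(\<Sum>i\<in>A. x i * esym_on (insert a A - {i}) j x)
        = (\<Sum>i\<in>A. x a * (x i * esym_on (A - {i}) m x) + x i * esym_on (A - {i}) j x)"
      using insert.hyps by (intro sum.cong refl) (simp add: del Suc esym_on_insert algebra_simps)
    also have "\<dots> = x a * ((real m + 1) * esym_on A j x) + (real j + 1) * esym_on A (Suc j) x"
      by (simp add: sum.distrib sum_distrib_left[symmetric] insert.IH Suc)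
    finally show ?thesis
      using insert.hyps by (simp add: aA esym_on_insert Suc algebra_simps)
  qed
qed

text \<open>
  Euler's identity in degree \<open>j + 2\<close>, after replacing \<open>x i * esym_on (A - {i}) j x\<close> by
  \<open>esym_on A (Suc j) x - esym_on (A - {i}) (Suc j) x\<close>.
\<close>
lemma sum_square_mult_esym_on_remove:
  assumes "finite A"
  shows "(\<Sum>i\<in>A. (x i)\<^sup>2 * esym_on (A - {i}) j x)
    = sum x A * esym_on A (Suc j) x - (real j + 2) * esym_on A (Suc (Suc j)) x"
proof -
  have "(\<Sum>i\<in>A. (x i)\<^sup>2 * esym_on (A - {i}) j x)
      = (\<Sum>i\<in>A. x i * esym_on A (Suc j) x - x i * esym_on (A - {i}) (Suc j) x)"
    using assms by (intro sum.cong refl)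
      (simp add: esym_on_remove[of A _ j x] power2_eq_square algebra_simps)
  also have "\<dots> = sum x A * esym_on A (Suc j) x - (real (Suc j) + 1) * esym_on A (Suc (Suc j)) x"
    unfolding sum_subtractf sum_mult_esym_on_remove[OF assms] by (simp add: sum_distrib_right)
  finally show ?thesis by simp
qed


section \<open>Quotients of consecutive elementary symmetric functions on the Garding cone\<close>

text \<open>
  The range of \<open>j\<close> includes \<open>0\<close>, where the condition holds automatically for finite \<open>A\<close>; this spares
  the inductions a separate treatment of the lowest degree.
\<close>
definition in_cone :: "'a set \<Rightarrow> nat \<Rightarrow> ('a \<Rightarrow> real) \<Rightarrow> bool" where
  "in_cone A k x \<longleftrightarrow> (\<forall>j\<le>k. esym_on A j x > 0)"

definition esym_quot :: "'a set \<Rightarrow> nat \<Rightarrow> ('a \<Rightarrow> real) \<Rightarrow> real" where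
  "esym_quot A k x = esym_on A (Suc k) x / esym_on A k x"

lemma in_cone_mono: "in_cone A k x \<Longrightarrow> j \<le> k \<Longrightarrow> in_cone A j x"
  by (simp add: in_cone_def)

lemma in_coneD: "in_cone A k x \<Longrightarrow> j \<le> k \<Longrightarrow> esym_on A j x > 0"
  by (simp add: in_cone_def)

lemma in_cone_Suc: "in_cone A (Suc k) x \<longleftrightarrow> in_cone A k x \<and> esym_on A (Suc k) x > 0"
  by (auto simp: in_cone_def le_Suc_eq)

lemma in_cone_0: "finite A \<Longrightarrow> in_cone A 0 x"
  by (simp add: in_cone_def)

lemma esym_quot_0: "finite A \<Longrightarrow> esym_quot A 0 x = sum x A"
  by (simp add: esym_quot_def esym_on_1)

lemma add_esym_quot_remove:
  assumes "finite A" "i \<in> A" "esym_on (A - {i}) k x > 0"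
  shows "x i + esym_quot (A - {i}) k x = esym_on A (Suc k) x / esym_on (A - {i}) k x"
  using assms by (simp add: esym_quot_def esym_on_remove[of A i k x] field_simps)

text \<open>
  This recursion carries all structural facts about the quotients. The summand is nondecreasing and
  concave as a function of \<open>x i\<close> and of the quotient of one degree less, so monotonicity and concavity
  pass from degree \<open>k\<close> to degree \<open>k + 1\<close>.
\<close>
lemma esym_quot_rec:
  assumes "finite A" "esym_on A (Suc k) x > 0" "\<And>i. i \<in> A \<Longrightarrow> esym_on (A - {i}) k x > 0"
  shows "(real k + 2) * esym_quot A (Suc k) x
    = (\<Sum>i\<in>A. x i - (x i)\<^sup>2 / (x i + esym_quot (A - {i}) k x))"
proof -
  have "(\<Sum>i\<in>A. (x i)\<^sup>2 / (x i + esym_quot (A - {i}) k x))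
      = (\<Sum>i\<in>A. (x i)\<^sup>2 * esym_on (A - {i}) k x) / esym_on A (Suc k) x"
    using assms by (simp add: sum_divide_distrib add_esym_quot_remove)
  also have "\<dots> = sum x A - (real k + 2) * esym_quot A (Suc k) x"
    unfolding sum_square_mult_esym_on_remove[OF assms(1)] esym_quot_def
    using assms(2) by (simp add: field_simps)
  finally show ?thesis by (simp add: sum_subtractf)
qed

lemma esym_on_add_coord:
  assumes "finite A" "i \<in> A"
  shows "esym_on A (Suc j) (x(i := x i + t)) = esym_on A (Suc j) x + t * esym_on (A - {i}) j x"
  using assms by (simp add: esym_on_remove[of A i] esym_on_fun_upd algebra_simps)

text \<open>
  As a function of the single coordinate \<open>s = x i\<close> the quotient is \<open>(s b + c) / (s a + b)\<close> with
  \<open>a\<close>, \<open>b\<close>, \<open>c\<close> not depending on \<open>s\<close>, and the sign of its increments is that of \<open>b\<^sup>2 - a c\<close>. Thus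
  Newton's inequality for the remaining variables comes for free from monotonicity.
\<close>
lemma newton_if_esym_quot_mono:
  assumes "finite A" "i \<in> A" "esym_on A (Suc k) x > 0" "esym_on (A - {i}) k x > 0"
    and "esym_quot A (Suc k) x \<le> esym_quot A (Suc k) (x(i := x i + 1))"
  shows "esym_on (A - {i}) (Suc (Suc k)) x * esym_on (A - {i}) k x \<le> (esym_on (A - {i}) (Suc k) x)\<^sup>2"
proof -
  let ?a = "esym_on (A - {i}) k x" and ?b = "esym_on (A - {i}) (Suc k) x"
    and ?c = "esym_on (A - {i}) (Suc (Suc k)) x"
  have num: "esym_on A (Suc (Suc k)) x = x i * ?b + ?c" and den: "esym_on A (Suc k) x = x i * ?a + ?b"
    using assms(1,2) by (simp_all add: esym_on_remove)
  have "(x i * ?b + ?c) / (x i * ?a + ?b) \<le> (x i * ?b + ?c + ?b) / (x i * ?a + ?b + ?a)"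
    using assms(5) unfolding esym_quot_def esym_on_add_coord[OF assms(1,2)] num den by simp
  moreover have "0 < x i * ?a + ?b" "0 < x i * ?a + ?b + ?a"
    using assms(3,4) by (simp_all add: den)
  ultimately have "(x i * ?b + ?c) * (x i * ?a + ?b + ?a) \<le> (x i * ?b + ?c + ?b) * (x i * ?a + ?b)"
    by (simp add: divide_le_eq pos_le_divide_eq)
  then show ?thesis by (simp add: power2_eq_square algebra_simps)
qed

text \<open>
  The two assertions need each other in the induction. Monotonicity in degree \<open>k\<close> gives Newton's
  inequality for the remaining variables, which makes \<open>esym_on (A - {i}) k x\<close> positive: otherwise
  positivity of \<open>esym_on A (Suc k) x\<close> and of \<open>esym_on A k x\<close> would contradict it. With this positivity
  the recursion applies and gives monotonicity in degree \<open>k + 1\<close>.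
\<close>
lemma in_cone_remove_and_esym_quot_mono:
  assumes "finite A" "in_cone A k x"
  shows "(\<forall>i\<in>A. \<forall>j<k. esym_on (A - {i}) j x > 0) \<and>
    (\<forall>i\<in>A. \<forall>t\<ge>0. esym_quot A k x \<le> esym_quot A k (x(i := x i + t)))"
  using assms
proof (induction k arbitrary: A x)
  case 0
  then have "sum x A \<le> sum (x(i := x i + t)) A" if "i \<in> A" "t \<ge> 0" for i t
    using that by (intro sum_mono) auto
  with 0 show ?case by (simp add: esym_quot_0)
next
  case (Suc k)
  note fin = \<open>finite A\<close> and cone = \<open>in_cone A (Suc k) x\<close>
  have cone': "in_cone A k x" using cone by (simp add: in_cone_Suc)
  have IH: "\<And>i j. i \<in> A \<Longrightarrow> j < k \<Longrightarrow> esym_on (A - {i}) j x > 0"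
    "\<And>i t. i \<in> A \<Longrightarrow> t \<ge> 0 \<Longrightarrow> esym_quot A k x \<le> esym_quot A k (x(i := x i + t))"
    using Suc.IH[OF fin cone'] by blast+
  have remove: "esym_on (A - {i}) k x > 0" if i: "i \<in> A" for i
  proof (cases k)
    case 0
    then show ?thesis using fin by simp
  next
    case (Suc m)
    let ?a = "esym_on (A - {i}) m x" and ?b = "esym_on (A - {i}) k x"
      and ?c = "esym_on (A - {i}) (Suc k) x"
    have a: "?a > 0" using IH i Suc by auto
    have "esym_on A k x > 0" using cone' by (simp add: in_coneD)
    then have newton: "?c * ?a \<le> ?b\<^sup>2"
      using newton_if_esym_quot_mono[OF fin i _ a] IH(2)[OF i zero_le_one] by (simp only: Suc)
    have p1: "x i * ?b + ?c > 0" using cone esym_on_remove[OF fin i, of k x] by (auto dest: in_coneD)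
    have p2: "x i * ?a + ?b > 0"
      using cone' esym_on_remove[OF fin i, of m x] by (auto dest: in_coneD simp: Suc)
    show ?thesis
    proof (rule ccontr)
      assume "\<not> ?b > 0"
      then have "?b * (x i * ?a + ?b) \<le> 0" using p2 by (simp add: mult_nonpos_nonneg)
      moreover have "(x i * ?b + ?c) * ?a > 0" using p1 a by simp
      ultimately show False using newton by (simp add: power2_eq_square algebra_simps)
    qed
  qed
  have removeall: "in_cone (A - {i}) k x" if "i \<in> A" for i
    using IH that remove unfolding in_cone_def by (auto simp: le_less)
  have "esym_quot A (Suc k) x \<le> esym_quot A (Suc k) (x(i := x i + t))" (is "_ \<le> esym_quot _ _ ?y")
    if i: "i \<in> A" and t: "t \<ge> 0" for i t
  proof -
    have cones: "esym_on (A - {j}) k ?y > 0" "esym_quot (A - {j}) k x \<le> esym_quot (A - {j}) k ?y"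
      if j: "j \<in> A" for j
    proof -
      show "esym_quot (A - {j}) k x \<le> esym_quot (A - {j}) k ?y"
      proof (cases "j = i")
        case True
        then show ?thesis by (simp add: esym_quot_def esym_on_fun_upd)
      next
        case False
        then have "i \<in> A - {j}" using i by simp
        with Suc.IH[OF _ removeall[OF j]] fin t show ?thesis by blast
      qed
      show "esym_on (A - {j}) k ?y > 0"
      proof (cases "j = i \<or> k = 0")
        case True
        then show ?thesis using remove[OF j] fin by (auto simp: esym_on_fun_upd)
      next
        case False
        then obtain m where m: "k = Suc m" by (cases k) auto
        have "esym_on (A - {j} - {i}) m x > 0"
          using Suc.IH[OF _ removeall[OF j]] fin i False m by auto
        moreover have "esym_on (A - {j}) k ?y = esym_on (A - {j}) k x + t * esym_on (A - {j} - {i}) m x"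
          unfolding m using fin i False by (intro esym_on_add_coord) auto
        ultimately show ?thesis using remove[OF j] t by (simp add: add_pos_nonneg)
      qed
    qed
    have pos_x: "esym_on A (Suc k) x > 0" using cone by (simp add: in_coneD)
    have pos_y: "esym_on A (Suc k) ?y > 0"
      using pos_x remove[OF i] t by (simp add: esym_on_add_coord[OF fin i] add_pos_nonneg)
    have den_x: "x j + esym_quot (A - {j}) k x > 0" if "j \<in> A" for j
      using add_esym_quot_remove[OF fin that remove[OF that]] pos_x remove[OF that] by simp
    have den_y: "?y j + esym_quot (A - {j}) k ?y > 0" if "j \<in> A" for j
      using add_esym_quot_remove[OF fin that cones(1)[OF that]] pos_y cones(1)[OF that] by simp
    have "(\<Sum>j\<in>A. x j - (x j)\<^sup>2 / (x j + esym_quot (A - {j}) k x))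
        \<le> (\<Sum>j\<in>A. ?y j - (?y j)\<^sup>2 / (?y j + esym_quot (A - {j}) k ?y))"
    proof (rule sum_mono)
      fix j assume j: "j \<in> A"
      show "x j - (x j)\<^sup>2 / (x j + esym_quot (A - {j}) k x)
        \<le> ?y j - (?y j)\<^sup>2 / (?y j + esym_quot (A - {j}) k ?y)"
      proof (cases "j = i")
        case True
        define r where "r = esym_quot (A - {i}) k x"
        have r: "esym_quot (A - {i}) k ?y = r"
          by (simp add: r_def esym_quot_def esym_on_fun_upd)
        have pos: "x i + r > 0" "x i + t + r > 0"
          using den_x[OF i] t by (auto simp: r_def)
        \<comment> \<open>As a function of its own coordinate \<open>s\<close> the summand is \<open>r - r\<^sup>2 / (s + r)\<close>, which increases.\<close>
        have eq: "s - s\<^sup>2 / (s + r) = r - r\<^sup>2 / (s + r)" if "s + r > 0" for s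
          using that by (simp add: field_simps power2_eq_square)
        have "r\<^sup>2 / (x i + t + r) \<le> r\<^sup>2 / (x i + r)"
          using pos t by (intro divide_left_mono) auto
        then show ?thesis using True eq[OF pos(1)] eq[OF pos(2)] by (simp add: r r_def[symmetric])
      next
        case False
        have "(x j)\<^sup>2 / (x j + esym_quot (A - {j}) k ?y) \<le> (x j)\<^sup>2 / (x j + esym_quot (A - {j}) k x)"
          using den_x[OF j] den_y[OF j] cones(2)[OF j] False by (intro divide_left_mono) auto
        then show ?thesis using False by simp
      qed
    qed
    then have "(real k + 2) * esym_quot A (Suc k) x \<le> (real k + 2) * esym_quot A (Suc k) ?y"
      using esym_quot_rec[OF fin pos_x remove] esym_quot_rec[OF fin pos_y cones(1)] by simp
    then show ?thesis by simp
  qed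
  with removeall show ?case unfolding in_cone_def less_Suc_eq_le by blast
qed

lemma in_cone_remove:
  assumes "finite A" "in_cone A (Suc k) x" "i \<in> A"
  shows "in_cone (A - {i}) k x"
  using in_cone_remove_and_esym_quot_mono[OF assms(1,2)] assms(3)
  by (auto simp: in_cone_def less_Suc_eq_le)

lemma newton_remove:
  assumes "finite A" "in_cone A (Suc k) x" "i \<in> A"
  shows "esym_on (A - {i}) (Suc (Suc k)) x * esym_on (A - {i}) k x \<le> (esym_on (A - {i}) (Suc k) x)\<^sup>2"
  using in_cone_remove_and_esym_quot_mono[OF assms(1,2)] in_cone_remove[OF assms] assms
  by (intro newton_if_esym_quot_mono) (auto dest: in_coneD)

lemma in_cone_remove_subset:
  assumes "finite A" "in_cone A (card B + k) x" "B \<subseteq> A"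
  shows "in_cone (A - B) k x"
proof -
  have "finite B" using assms finite_subset by auto
  then show ?thesis using assms
  proof (induction arbitrary: k)
    case (insert b B)
    then have "in_cone (A - B) (Suc k) x" by simp
    then have "in_cone (A - B - {b}) k x" using insert by (intro in_cone_remove) auto
    then show ?case by (metis Diff_insert)
  qed simp
qed

text \<open>
  Joint convexity and homogeneity of \<open>a\<^sup>2 / c\<close>, in additive form.
\<close>
lemma square_add_div_le:
  fixes a b c d :: real
  assumes "c > 0" "d > 0"
  shows "(a + b)\<^sup>2 / (c + d) \<le> a\<^sup>2 / c + b\<^sup>2 / d"
proof -
  have "a\<^sup>2 / c + b\<^sup>2 / d - (a + b)\<^sup>2 / (c + d) = (a * d - b * c)\<^sup>2 / (c * d * (c + d))"
    using assms by (simp add: divide_simps) (simp add: algebra_simps power2_eq_square)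
  also have "\<dots> \<ge> 0" using assms by simp
  finally show ?thesis by simp
qed

text \<open>
  For a function that is homogeneous of degree one, superadditivity is the same as concavity. In this
  form the recursion can be used without derivatives, and convexity of the cone is part of the
  induction: superadditivity in degree \<open>k\<close> makes \<open>esym_on A (Suc k)\<close> positive at the sum.
\<close>
lemma esym_quot_superadditive:
  assumes "finite A" "in_cone A k x" "in_cone A k y"
  shows "in_cone A k (\<lambda>i. x i + y i) \<and>
    esym_quot A k x + esym_quot A k y \<le> esym_quot A k (\<lambda>i. x i + y i)"
  using assms
proof (induction k arbitrary: A)
  case 0
  then show ?case by (simp add: esym_quot_0 in_cone_0 sum.distrib)
next
  case (Suc k)
  let ?z = "\<lambda>i. x i + y i"
  note fin = \<open>finite A\<close> and cone = \<open>in_cone A (Suc k) x\<close> \<open>in_cone A (Suc k) y\<close>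
  have IH0: "in_cone A k ?z" "esym_quot A k x + esym_quot A k y \<le> esym_quot A k ?z"
    using Suc.IH[OF fin] cone by (auto simp: in_cone_Suc)
  have "esym_quot A k x > 0" "esym_quot A k y > 0"
    using cone by (auto simp: esym_quot_def in_cone_def)
  with IH0(2) have "esym_quot A k ?z > 0" by linarith
  then have pos_z: "esym_on A (Suc k) ?z > 0"
    using in_coneD[OF IH0(1) order_refl] by (simp add: esym_quot_def zero_less_divide_iff)
  with IH0 have cone_z: "in_cone A (Suc k) ?z" by (simp add: in_cone_Suc)
  have pos_x: "esym_on A (Suc k) x > 0" and pos_y: "esym_on A (Suc k) y > 0"
    using cone by (auto dest: in_coneD)
  have rem_x: "esym_on (A - {i}) k x > 0" if "i \<in> A" for i
    using in_cone_remove[OF fin cone(1) that] by (simp add: in_coneD)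
  have rem_y: "esym_on (A - {i}) k y > 0" if "i \<in> A" for i
    using in_cone_remove[OF fin cone(2) that] by (simp add: in_coneD)
  have rem_z: "esym_on (A - {i}) k ?z > 0" if "i \<in> A" for i
    using in_cone_remove[OF fin cone_z that] by (simp add: in_coneD)
  have "(\<Sum>i\<in>A. x i - (x i)\<^sup>2 / (x i + esym_quot (A - {i}) k x))
      + (\<Sum>i\<in>A. y i - (y i)\<^sup>2 / (y i + esym_quot (A - {i}) k y))
      \<le> (\<Sum>i\<in>A. ?z i - (?z i)\<^sup>2 / (?z i + esym_quot (A - {i}) k ?z))"
    unfolding sum.distrib[symmetric]
  proof (rule sum_mono)
    fix i assume i: "i \<in> A"
    define u v w where "u = x i + esym_quot (A - {i}) k x" "v = y i + esym_quot (A - {i}) k y"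
      "w = ?z i + esym_quot (A - {i}) k ?z"
    have uv: "u > 0" "v > 0"
      using add_esym_quot_remove[OF fin i rem_x[OF i]] add_esym_quot_remove[OF fin i rem_y[OF i]]
        pos_x pos_y rem_x[OF i] rem_y[OF i] by (simp_all add: u_v_w_def)
    have "u + v \<le> w"
      using Suc.IH[of "A - {i}"] fin in_cone_remove[OF fin _ i] cone by (simp add: u_v_w_def)
    then have "(?z i)\<^sup>2 / w \<le> (?z i)\<^sup>2 / (u + v)"
      using uv by (intro divide_left_mono) auto
    also have "\<dots> \<le> (x i)\<^sup>2 / u + (y i)\<^sup>2 / v"
      using uv by (rule square_add_div_le)
    finally show "x i - (x i)\<^sup>2 / (x i + esym_quot (A - {i}) k x)
        + (y i - (y i)\<^sup>2 / (y i + esym_quot (A - {i}) k y))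
      \<le> ?z i - (?z i)\<^sup>2 / (?z i + esym_quot (A - {i}) k ?z)"
      by (simp add: u_v_w_def)
  qed
  then have "(real k + 2) * (esym_quot A (Suc k) x + esym_quot A (Suc k) y)
      \<le> (real k + 2) * esym_quot A (Suc k) ?z"
    using esym_quot_rec[OF fin pos_x rem_x] esym_quot_rec[OF fin pos_y rem_y]
      esym_quot_rec[OF fin pos_z rem_z] by (simp add: distrib_left)
  with cone_z show ?case by simp
qed


section \<open>Comparison of the Hessians of the logarithms\<close>

text \<open>
  A finite form of the concavity of \<open>ln (esym_on A k) - ln (esym_on A l)\<close>: its values at \<open>u\<close> and \<open>v\<close>
  are compared with twice the value at their midpoint. One step from \<open>k\<close> to \<open>k + 1\<close> multiplies the left
  side by \<open>a b / c\<^sup>2\<close> for the quotients \<open>a\<close>, \<open>b\<close>, \<open>c\<close> at \<open>u\<close>, \<open>v\<close>, \<open>x\<close>, and \<open>a b \<le> c\<^sup>2\<close> because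
  \<open>a + b \<le> 2 c\<close>.
\<close>
lemma esym_on_midpoint_quotient_le:
  assumes "finite A" "l \<le> k" "in_cone A k u" "in_cone A k v"
    and x: "\<And>i. u i + v i = 2 * x i"
  shows "esym_on A k u * esym_on A k v / (esym_on A k x)\<^sup>2
    \<le> esym_on A l u * esym_on A l v / (esym_on A l x)\<^sup>2"
  using assms(2-4)
proof (induction k rule: dec_induct)
  case base
  then show ?case by simp
next
  case (step k)
  have cone: "in_cone A k u" "in_cone A k v" using step.prems by (simp_all add: in_cone_Suc)
  define a b c where "a = esym_quot A k u" "b = esym_quot A k v" "c = esym_quot A k x"
  have "in_cone A k (\<lambda>i. 2 * x i)" "a + b \<le> esym_quot A k (\<lambda>i. 2 * x i)"
    using esym_quot_superadditive[OF assms(1) cone] by (simp_all add: x a_b_c_def)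
  then have le: "a + b \<le> 2 * c" and pos_x: "esym_on A k x > 0"
    by (auto simp: esym_quot_def esym_on_scale a_b_c_def zero_less_mult_iff dest: in_coneD)
  have pos: "esym_on A k u > 0" "esym_on A k v > 0" "a > 0" "b > 0"
    using step.prems by (simp_all add: a_b_c_def esym_quot_def in_cone_def)
  have "(2 * c)\<^sup>2 \<ge> (a + b)\<^sup>2" using le pos by (intro power_mono) auto
  then have "a * b \<le> c\<^sup>2" using sum_squares_ge_zero[of "a - b" 0] by (simp add: power2_eq_square algebra_simps)
  moreover have "c > 0" using le pos by simp
  ultimately have "a * b / c\<^sup>2 \<le> 1" by simp
  then have "esym_on A k u * esym_on A k v / (esym_on A k x)\<^sup>2 * (a * b / c\<^sup>2)
      \<le> esym_on A k u * esym_on A k v / (esym_on A k x)\<^sup>2"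
    using pos by (intro mult_left_le) auto
  moreover have "esym_on A (Suc k) u * esym_on A (Suc k) v / (esym_on A (Suc k) x)\<^sup>2
      = esym_on A k u * esym_on A k v / (esym_on A k x)\<^sup>2 * (a * b / c\<^sup>2)"
    using pos pos_x by (simp add: a_b_c_def esym_quot_def field_simps)
  ultimately show ?case using step.IH[OF cone] by linarith
qed

text \<open>
  First and second derivative in direction \<open>v\<close>, given by their coefficients rather than as limits, so
  that the Taylor expansion becomes an algebraic induction.
\<close>
primrec esym_dir :: "'a set \<Rightarrow> nat \<Rightarrow> ('a \<Rightarrow> real) \<Rightarrow> ('a \<Rightarrow> real) \<Rightarrow> real" where
  "esym_dir A 0 x v = 0"
| "esym_dir A (Suc j) x v = (\<Sum>i\<in>A. v i * esym_on (A - {i}) j x)"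

primrec esym_dir2 :: "'a set \<Rightarrow> nat \<Rightarrow> ('a \<Rightarrow> real) \<Rightarrow> ('a \<Rightarrow> real) \<Rightarrow> real" where
  "esym_dir2 A 0 x v = 0"
| "esym_dir2 A (Suc j) x v = (\<Sum>i\<in>A. v i * esym_dir (A - {i}) j x v)"

text \<open>
  These two rules are the Leibniz rule for \<open>x a * esym_on A j x + esym_on A (Suc j) x\<close>; they let the
  Taylor expansion be proved by adding one variable at a time.
\<close>
lemma esym_dir_insert:
  assumes "finite A" "a \<notin> A"
  shows "esym_dir (insert a A) (Suc j) x v
    = v a * esym_on A j x + x a * esym_dir A j x v + esym_dir A (Suc j) x v"
proof -
  have del: "insert a A - {i} = insert a (A - {i})" if "i \<in> A" for i
    using that assms by auto
  have "(\<Sum>i\<in>A. v i * esym_on (insert a A - {i}) j x) = x a * esym_dir A j x v + esym_dir A (Suc j) x v"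
    using assms
    by (cases j) (simp_all add: del esym_on_insert sum_distrib_left sum.distrib algebra_simps)
  then show ?thesis using assms by simp
qed

lemma esym_dir2_insert:
  assumes "finite A" "a \<notin> A"
  shows "esym_dir2 (insert a A) (Suc j) x v
    = 2 * v a * esym_dir A j x v + x a * esym_dir2 A j x v + esym_dir2 A (Suc j) x v"
proof -
  have del: "insert a A - {i} = insert a (A - {i})" if "i \<in> A" for i
    using that assms by auto
  have "(\<Sum>i\<in>A. v i * esym_dir (insert a A - {i}) j x v)
      = v a * esym_dir A j x v + x a * esym_dir2 A j x v + esym_dir2 A (Suc j) x v"
    using assms
    by (cases j) (simp_all add: del esym_dir_insert sum_distrib_left sum.distrib algebra_simps
        del: esym_dir.simps(2), simp_all add: sum_distrib_left sum.distrib algebra_simps)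
  then show ?thesis using assms by simp
qed

lemma esym_on_taylor:
  assumes "finite A"
  shows "\<exists>R :: real \<Rightarrow> real. continuous_on UNIV R \<and> (\<forall>t. esym_on A j (\<lambda>i. x i + t * v i)
    = esym_on A j x + t * esym_dir A j x v + t\<^sup>2 / 2 * esym_dir2 A j x v + t ^ 3 * R t)"
  using assms
proof (induction arbitrary: j)
  case empty
  then show ?case by (intro exI[of _ "\<lambda>_. 0"]) (cases j; simp)
next
  case (insert a A)
  show ?case
  proof (cases j)
    case 0
    with insert.hyps show ?thesis by (intro exI[of _ "\<lambda>_. 0"]) simp
  next
    case (Suc m)
    obtain R where R: "continuous_on UNIV R" "\<And>t. esym_on A m (\<lambda>i. x i + t * v i)
        = esym_on A m x + t * esym_dir A m x v + t\<^sup>2 / 2 * esym_dir2 A m x v + t ^ 3 * R t"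
      using insert.IH[of m] by blast
    obtain R' where R': "continuous_on UNIV R'" "\<And>t. esym_on A j (\<lambda>i. x i + t * v i)
        = esym_on A j x + t * esym_dir A j x v + t\<^sup>2 / 2 * esym_dir2 A j x v + t ^ 3 * R' t"
      using insert.IH[of j] by blast
    let ?S = "\<lambda>t. x a * R t + v a * esym_dir2 A m x v / 2 + t * v a * R t + R' t"
    have "continuous_on UNIV ?S" by (intro continuous_intros R R')
    moreover have "esym_on (insert a A) j (\<lambda>i. x i + t * v i) = esym_on (insert a A) j x
      + t * esym_dir (insert a A) j x v + t\<^sup>2 / 2 * esym_dir2 (insert a A) j x v + t ^ 3 * ?S t" for t
      using R(2)[of t] R'(2)[of t] insert.hyps unfolding Suc
      by (simp add: esym_on_insert esym_dir_insert esym_dir2_insert del: esym_dir.simps esym_dir2.simps)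
        (simp add: field_simps power2_eq_square power3_eq_cube)
    ultimately show ?thesis by blast
  qed
qed

text \<open>
  In \<open>f t * f (- t)\<close> the odd powers of \<open>t\<close> cancel, so its second-order coefficient
  \<open>a c - b\<^sup>2\<close> is, for \<open>a > 0\<close>, \<open>a\<^sup>2\<close> times the second derivative of \<open>ln f\<close> at \<open>0\<close>.
\<close>
lemma second_order_product_limit:
  fixes f R :: "real \<Rightarrow> real"
  assumes f: "\<And>t. f t = a + t * b + t\<^sup>2 / 2 * c + t ^ 3 * R t" and R: "continuous_on UNIV R"
  shows "((\<lambda>t. (f t * f (- t) - a\<^sup>2) / t\<^sup>2) \<longlongrightarrow> a * c - b\<^sup>2) (at 0)"
proof -
  \<comment> \<open>The difference quotient with \<open>t\<^sup>2\<close> cancelled: a continuous function with the right value at \<open>0\<close>.\<close>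
  let ?g = "\<lambda>t. a * c + c\<^sup>2 * t\<^sup>2 / 4 + (a + c * t\<^sup>2 / 2) * t * (R t - R (- t))
    - (b + t\<^sup>2 * R t) * (b + t\<^sup>2 * R (- t))"
  have R': "continuous_on UNIV (\<lambda>t. R (- t))"
    by (rule continuous_on_compose2[OF R]) (auto intro: continuous_intros)
  have "continuous_on UNIV ?g" by (intro continuous_intros R R') auto
  then have "(?g \<longlongrightarrow> ?g 0) (at 0)"
    by (simp only: continuous_on_eq_continuous_at[OF open_UNIV] isCont_def) blast
  moreover have "eventually (\<lambda>t. ?g t = (f t * f (- t) - a\<^sup>2) / t\<^sup>2) (at 0)"
    unfolding eventually_at_filter
  proof (intro always_eventually allI impI)
    fix t :: real assume "t \<noteq> 0"
    moreover have "f t * f (- t) - a\<^sup>2 = ?g t * t\<^sup>2"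
      unfolding f by (simp add: field_simps power2_eq_square power3_eq_cube)
    ultimately show "?g t = (f t * f (- t) - a\<^sup>2) / t\<^sup>2" by simp
  qed
  ultimately have "((\<lambda>t. (f t * f (- t) - a\<^sup>2) / t\<^sup>2) \<longlongrightarrow> ?g 0) (at 0)"
    by (rule Lim_transform_eventually)
  then show ?thesis by (simp add: power2_eq_square)
qed

lemma eventually_in_cone:
  assumes "finite A" "in_cone A k x"
  shows "eventually (\<lambda>t. in_cone A k (\<lambda>i. x i + t * v i)) (at 0)"
proof -
  have "eventually (\<lambda>t. esym_on A j (\<lambda>i. x i + t * v i) > 0) (at 0)" if "j \<in> {..k}" for j
  proof -
    have "continuous_on UNIV (\<lambda>t. esym_on A j (\<lambda>i. x i + t * v i))"
      unfolding esym_on_def by (intro continuous_intros)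
    then have "((\<lambda>t. esym_on A j (\<lambda>i. x i + t * v i)) \<longlongrightarrow> esym_on A j (\<lambda>i. x i + 0 * v i)) (at 0)"
      by (simp only: continuous_on_eq_continuous_at[OF open_UNIV] isCont_def) blast
    then show ?thesis using assms(2) that by (intro order_tendstoD) (auto simp: in_cone_def)
  qed
  then have "eventually (\<lambda>t. \<forall>j\<in>{..k}. esym_on A j (\<lambda>i. x i + t * v i) > 0) (at 0)"
    by (intro eventually_ball_finite) auto
  then show ?thesis by (simp add: in_cone_def Ball_def)
qed

text \<open>
  Both sides are \<open>- D\<^sup>2 ln\<close> of an elementary symmetric function in direction \<open>v\<close>. The midpoint
  inequality is applied to \<open>x + t v\<close> and \<open>x - t v\<close>, divided by \<open>t\<^sup>2\<close>, and \<open>t\<close> tends to \<open>0\<close>.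
\<close>
lemma ln_esym_on_Hessian_mono:
  assumes fin: "finite A" and lk: "l \<le> k" and cone: "in_cone A k x"
  shows "(esym_dir A l x v / esym_on A l x)\<^sup>2 - esym_dir2 A l x v / esym_on A l x
    \<le> (esym_dir A k x v / esym_on A k x)\<^sup>2 - esym_dir2 A k x v / esym_on A k x"
proof -
  let ?E = "\<lambda>j t. esym_on A j (\<lambda>i. x i + t * v i)"
  have pos: "esym_on A l x > 0" "esym_on A k x > 0"
    using cone lk by (auto dest: in_coneD)
  have lim: "((\<lambda>t. (?E j t * ?E j (- t) - (esym_on A j x)\<^sup>2) / t\<^sup>2 / (esym_on A j x)\<^sup>2)
      \<longlongrightarrow> (esym_on A j x * esym_dir2 A j x v - (esym_dir A j x v)\<^sup>2) / (esym_on A j x)\<^sup>2) (at 0)"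
    if "esym_on A j x > 0" for j
  proof -
    obtain R where "continuous_on UNIV R"
      "\<And>t. ?E j t = esym_on A j x + t * esym_dir A j x v + t\<^sup>2 / 2 * esym_dir2 A j x v + t ^ 3 * R t"
      using esym_on_taylor[OF fin, of j x v] by blast
    then show ?thesis using that
      by (intro tendsto_divide tendsto_const second_order_product_limit[where R = R]) auto
  qed
  have "eventually (\<lambda>t. in_cone A k (\<lambda>i. x i + t * v i)) (at 0)"
    "eventually (\<lambda>t. in_cone A k (\<lambda>i. x i + t * - v i)) (at 0)"
    using eventually_in_cone[OF fin cone, of v] eventually_in_cone[OF fin cone, of "\<lambda>i. - v i"] by auto
  then have "eventually (\<lambda>t. (?E k t * ?E k (- t) - (esym_on A k x)\<^sup>2) / t\<^sup>2 / (esym_on A k x)\<^sup>2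
    \<le> (?E l t * ?E l (- t) - (esym_on A l x)\<^sup>2) / t\<^sup>2 / (esym_on A l x)\<^sup>2) (at 0)"
  proof eventually_elim
    case (elim t)
    have "?E k t * ?E k (- t) / (esym_on A k x)\<^sup>2 \<le> ?E l t * ?E l (- t) / (esym_on A l x)\<^sup>2"
      using elim by (intro esym_on_midpoint_quotient_le[OF fin lk]) auto
    then have "(?E k t * ?E k (- t) / (esym_on A k x)\<^sup>2 - 1) / t\<^sup>2
        \<le> (?E l t * ?E l (- t) / (esym_on A l x)\<^sup>2 - 1) / t\<^sup>2"
      by (intro divide_right_mono) auto
    moreover have "(p / s - 1) / t\<^sup>2 = (p - s) / t\<^sup>2 / s" if "s \<noteq> 0" for p s
      using that by (simp add: field_simps)
    ultimately show ?case using pos by simp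
  qed
  from tendsto_le[OF _ lim[OF pos(1)] lim[OF pos(2)] this]
  have "(esym_on A k x * esym_dir2 A k x v - (esym_dir A k x v)\<^sup>2) / (esym_on A k x)\<^sup>2
    \<le> (esym_on A l x * esym_dir2 A l x v - (esym_dir A l x v)\<^sup>2) / (esym_on A l x)\<^sup>2"
    by simp
  then show ?thesis using pos
    by (simp add: diff_divide_distrib power_divide power2_eq_square)
qed


section \<open>Size estimates\<close>

text \<open>
  After expanding both functions of \<open>A\<close> in the variable \<open>x i\<close> this is Newton's inequality on \<open>A - {i}\<close>.
\<close>
lemma esym_quot_le_remove:
  assumes "finite A" "in_cone A (Suc k) x" "i \<in> A"
  shows "esym_quot A (Suc k) x \<le> esym_quot (A - {i}) k x"
proof -
  have pos: "esym_on A (Suc k) x > 0" "esym_on (A - {i}) k x > 0"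
    using in_cone_remove[OF assms] assms(2) by (simp_all add: in_coneD)
  have "esym_on A (Suc (Suc k)) x * esym_on (A - {i}) k x
      \<le> esym_on A (Suc k) x * esym_on (A - {i}) (Suc k) x"
    using newton_remove[OF assms] assms(1,3)
    by (simp add: esym_on_remove[of A i] power2_eq_square algebra_simps)
  then show ?thesis using pos by (simp add: esym_quot_def divide_simps mult.commute)
qed

text \<open>
  Deleting the variables in \<open>B\<close> one by one lowers the degree to \<open>0\<close>, where the quotient is the sum of
  the variables that are left.
\<close>
lemma esym_quot_le_sum:
  assumes "finite A" "B \<subseteq> A" "in_cone A (card B) x"
  shows "esym_quot A (card B) x \<le> sum x (A - B)"
proof -
  have "finite B" using assms finite_subset by auto
  then show ?thesis using assms
  proof (induction arbitrary: A)
    case empty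
    then show ?case by (simp add: esym_quot_0)
  next
    case (insert b B)
    have cone: "in_cone A (Suc (card B)) x" using insert by simp
    have b: "b \<in> A" using insert by simp
    have "esym_quot A (Suc (card B)) x \<le> esym_quot (A - {b}) (card B) x"
      using insert.prems(1) cone b by (rule esym_quot_le_remove)
    also have "\<dots> \<le> sum x (A - {b} - B)"
      using insert in_cone_remove[OF insert.prems(1) cone b] by (intro insert.IH) auto
    also have "A - {b} - B = A - insert b B" by auto
    finally show ?case using insert by simp
  qed
qed

text \<open>
  The sum on the right avoids \<open>B\<close>: if \<open>B\<close> contains the large entries, the derivative in direction \<open>q\<close>
  dominates the function divided by a small quantity.
\<close>
lemma esym_on_le_sum_mult_remove:
  assumes "finite A" "q \<in> A" "B \<subseteq> A - {q}" "in_cone A (Suc (card B)) x"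
  shows "esym_on A (Suc (card B)) x \<le> sum x (A - B) * esym_on (A - {q}) (card B) x"
proof -
  have cone: "in_cone (A - {q}) (card B) x" using assms by (intro in_cone_remove)
  then have pos: "esym_on (A - {q}) (card B) x > 0" by (simp add: in_coneD)
  have "x q + esym_quot (A - {q}) (card B) x \<le> x q + sum x (A - {q} - B)"
    using assms cone by (intro add_left_mono esym_quot_le_sum) auto
  also have "\<dots> = sum x (A - B)"
    using assms sum.remove[of "A - B" q x] by (auto simp: Diff_eq Int_commute Int_left_commute)
  finally show ?thesis
    unfolding add_esym_quot_remove[OF assms(1,2) pos] using pos by (simp add: divide_le_eq)
qed

text \<open>
  Expanding in one variable of \<open>B\<close> after another, the part free of that variable is dropped. It is
  positive because the order of the cone exceeds the degree by one.
\<close>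
lemma prod_le_esym_on:
  assumes "finite A" "B \<subseteq> A" "in_cone A (Suc (card B)) x" "\<And>i. i \<in> B \<Longrightarrow> x i \<ge> 0"
  shows "(\<Prod>i\<in>B. x i) \<le> esym_on A (card B) x"
proof -
  have "finite B" using assms finite_subset by auto
  then show ?thesis using assms
  proof (induction arbitrary: A)
    case empty
    then show ?case by simp
  next
    case (insert b B)
    have cone: "in_cone (A - {b}) (Suc (card B)) x"
      using insert by (intro in_cone_remove) auto
    have "(\<Prod>i\<in>insert b B. x i) = x b * (\<Prod>i\<in>B. x i)" using insert by simp
    also have "\<dots> \<le> x b * esym_on (A - {b}) (card B) x"
      using insert cone by (intro mult_left_mono insert.IH) auto
    also have "\<dots> \<le> esym_on A (Suc (card B)) x"
      using insert.prems in_coneD[OF cone order_refl] by (simp add: esym_on_remove[of A b])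
    finally show ?case using insert by simp
  qed
qed

lemma abs_esym_on_le:
  assumes "finite A" "\<And>S. S \<subseteq> A \<Longrightarrow> card S = j \<Longrightarrow> (\<Prod>i\<in>S. \<bar>x i\<bar>) \<le> c" "0 \<le> c" "card A \<le> n"
  shows "\<bar>esym_on A j x\<bar> \<le> 2 ^ n * c"
proof -
  have "\<bar>esym_on A j x\<bar> \<le> (\<Sum>S | S \<subseteq> A \<and> card S = j. \<bar>\<Prod>i\<in>S. x i\<bar>)"
    unfolding esym_on_def by (rule sum_abs)
  also have "\<dots> \<le> real (card {S. S \<subseteq> A \<and> card S = j}) * c"
    using assms(2) by (intro sum_bounded_above) (auto simp: abs_prod)
  also have "card {S. S \<subseteq> A \<and> card S = j} \<le> card (Pow A)"
    using assms(1) by (intro card_mono) auto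
  also have "\<dots> = 2 ^ card A" using assms(1) by (rule card_Pow)
  also have "\<dots> \<le> 2 ^ n" using assms(4) by (intro power_increasing) auto
  finally show ?thesis using assms(3) by (simp add: mult_right_mono)
qed

lemma abs_esym_on_le_power:
  assumes "finite A" "\<And>i. i \<in> A \<Longrightarrow> \<bar>x i\<bar> \<le> M" "0 \<le> M" "card A \<le> n"
  shows "\<bar>esym_on A j x\<bar> \<le> 2 ^ n * M ^ j"
proof (rule abs_esym_on_le[OF assms(1) _ _ assms(4)])
  fix S assume "S \<subseteq> A" "card S = j"
  then show "(\<Prod>i\<in>S. \<bar>x i\<bar>) \<le> M ^ j"
    using assms(2) prod_mono[of S "\<lambda>i. \<bar>x i\<bar>" "\<lambda>_. M"] by auto
qed (use assms in simp)

text \<open>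
  The entries outside \<open>L\<close> are small. When fewer than \<open>j\<close> indices of \<open>A\<close> lie in \<open>L\<close>, each monomial of
  degree \<open>j\<close> contains a small factor.
\<close>
lemma abs_esym_on_le_small:
  assumes "finite A" "\<And>i. i \<in> A \<Longrightarrow> \<bar>x i\<bar> \<le> M" "0 \<le> M" "card A \<le> n"
    and "\<And>i. i \<in> A - L \<Longrightarrow> \<bar>x i\<bar> \<le> \<tau> * M" "0 \<le> \<tau>" "card (A \<inter> L) < j"
  shows "\<bar>esym_on A j x\<bar> \<le> 2 ^ n * (\<tau> * M ^ j)"
proof (rule abs_esym_on_le[OF assms(1) _ _ assms(4)])
  fix S assume S: "S \<subseteq> A" "card S = j"
  have "\<not> S \<subseteq> A \<inter> L"
    using card_mono[of "A \<inter> L" S] assms(1,7) S by auto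
  then obtain b where b: "b \<in> S" "b \<in> A - L" using S by auto
  have fin: "finite S" using S assms(1) finite_subset by blast
  have "(\<Prod>i\<in>S. \<bar>x i\<bar>) = \<bar>x b\<bar> * (\<Prod>i\<in>S - {b}. \<bar>x i\<bar>)"
    using fin b by (simp add: prod.remove)
  also have "\<dots> \<le> (\<tau> * M) * (\<Prod>i\<in>S - {b}. M)"
    using assms(2,3,5,6) b S by (intro mult_mono prod_mono) (auto intro: prod_nonneg)
  also have "\<dots> = \<tau> * M ^ j"
    using fin b S by (cases j) (auto simp: card_Diff_singleton)
  finally show "(\<Prod>i\<in>S. \<bar>x i\<bar>) \<le> \<tau> * M ^ j" .
qed (use assms in simp)


section \<open>The Hessian of the logarithm\<close>

text \<open>
  \<open>\<sigma>\<^sub>m\<^sup>2 - \<sigma>\<^sub>m\<^sub>+\<^sub>1 \<sigma>\<^sub>m\<^sub>-\<^sub>1\<close> with \<open>\<sigma>\<^sub>-\<^sub>1 = 0\<close>.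
\<close>
definition mixed_minor :: "'a set \<Rightarrow> nat \<Rightarrow> ('a \<Rightarrow> real) \<Rightarrow> real" where
  "mixed_minor A m x = (esym_on A m x)\<^sup>2
    - esym_on A (Suc m) x * (case m of 0 \<Rightarrow> 0 | Suc m' \<Rightarrow> esym_on A m' x)"

text \<open>
  The right-hand side is \<open>\<sigma>\<^sub>p \<sigma>\<^sub>q - \<sigma> \<sigma>\<^sub>p\<^sub>q\<close> for \<open>\<sigma> = esym_on A (Suc m)\<close> and its partial derivatives.
  All dependence on \<open>x p\<close> and \<open>x q\<close> cancels, which is why the coefficient is small when
  both are among the large entries.
\<close>
lemma mixed_minor_eq:
  assumes "finite A" "p \<in> A" "q \<in> A" "p \<noteq> q"
  shows "mixed_minor (A - {p} - {q}) m x = esym_on (A - {p}) m x * esym_on (A - {q}) m x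
    - esym_on A (Suc m) x * (case m of 0 \<Rightarrow> 0 | Suc m' \<Rightarrow> esym_on (A - {p} - {q}) m' x)"
proof (cases m)
  case 0
  then show ?thesis using assms by (simp add: mixed_minor_def)
next
  case (Suc m')
  have swap: "A - {q} - {p} = A - {p} - {q}" by auto
  show ?thesis
    using assms esym_on_remove[of "A - {p}" q _ x] esym_on_remove[of "A - {q}" p _ x]
    by (simp add: Suc mixed_minor_def esym_on_remove[of A p] swap power2_eq_square algebra_simps)
qed

text \<open>
  The quadratic form \<open>- \<sigma>\<^sup>2 D\<^sup>2 ln \<sigma>\<close> with its diagonal separated from the rest.
\<close>
lemma ln_esym_on_Hessian_form:
  assumes "finite A"
  shows "(esym_dir A (Suc m) x v)\<^sup>2 - esym_on A (Suc m) x * esym_dir2 A (Suc m) x v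
    = (\<Sum>p\<in>A. (esym_on (A - {p}) m x)\<^sup>2 * (v p)\<^sup>2)
      + (\<Sum>p\<in>A. \<Sum>q\<in>A - {p}. mixed_minor (A - {p} - {q}) m x * (v p * v q))"
proof -
  let ?E = "\<lambda>p q. case m of 0 \<Rightarrow> 0 | Suc m' \<Rightarrow> esym_on (A - {p} - {q}) m' x"
  have dir: "esym_dir (A - {p}) m x v = (\<Sum>q\<in>A - {p}. v q * ?E p q)" for p
    by (cases m) simp_all
  have dir2: "esym_on A (Suc m) x * esym_dir2 A (Suc m) x v
      = (\<Sum>p\<in>A. \<Sum>q\<in>A - {p}. (esym_on A (Suc m) x * ?E p q) * (v p * v q))"
    by (simp add: dir sum_distrib_left mult_ac)
  have minors: "(\<Sum>p\<in>A. \<Sum>q\<in>A - {p}. mixed_minor (A - {p} - {q}) m x * (v p * v q))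
      = (\<Sum>p\<in>A. \<Sum>q\<in>A - {p}. (esym_on (A - {p}) m x * esym_on (A - {q}) m x) * (v p * v q))
        - esym_on A (Suc m) x * esym_dir2 A (Suc m) x v"
    unfolding dir2 sum_subtractf[symmetric] left_diff_distrib[symmetric]
    using assms by (intro sum.cong refl arg_cong2[where f = "(*)"] mixed_minor_eq) auto
  have "(esym_dir A (Suc m) x v)\<^sup>2
      = (\<Sum>p\<in>A. \<Sum>q\<in>A. (esym_on (A - {p}) m x * esym_on (A - {q}) m x) * (v p * v q))"
    by (simp add: power2_eq_square sum_product mult_ac)
  also have "\<dots> = (\<Sum>p\<in>A. (esym_on (A - {p}) m x)\<^sup>2 * (v p)\<^sup>2
      + (\<Sum>q\<in>A - {p}. (esym_on (A - {p}) m x * esym_on (A - {q}) m x) * (v p * v q)))"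
    using assms by (intro sum.cong refl) (simp add: sum.remove power2_eq_square)
  finally show ?thesis unfolding minors by (simp only: sum.distrib)
qed

lemma abs_mixed_minor_le:
  assumes "\<bar>esym_on A m x\<bar> \<le> C * (\<tau> * M ^ m)" "\<bar>esym_on A (Suc m) x\<bar> \<le> C * (\<tau> * M ^ Suc m)"
    and "\<And>j. \<bar>esym_on A j x\<bar> \<le> C * M ^ j" "0 \<le> \<tau>" "\<tau> \<le> 1" "0 \<le> M" "0 \<le> C"
  shows "\<bar>mixed_minor A m x\<bar> \<le> 2 * C\<^sup>2 * \<tau> * (M ^ m)\<^sup>2"
proof -
  let ?E = "case m of 0 \<Rightarrow> 0 | Suc m' \<Rightarrow> esym_on A m' x"
  have "\<bar>esym_on A m x\<bar> * \<bar>esym_on A m x\<bar> \<le> (C * (\<tau> * M ^ m)) * (C * M ^ m)"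
    using assms by (intro mult_mono) auto
  then have 1: "(esym_on A m x)\<^sup>2 \<le> C\<^sup>2 * \<tau> * (M ^ m)\<^sup>2"
    by (simp add: power2_eq_square algebra_simps)
  have 2: "\<bar>esym_on A (Suc m) x * ?E\<bar> \<le> C\<^sup>2 * \<tau> * (M ^ m)\<^sup>2"
  proof (cases m)
    case 0
    then show ?thesis using assms by simp
  next
    case (Suc m')
    have "\<bar>esym_on A (Suc m) x\<bar> * \<bar>esym_on A m' x\<bar> \<le> (C * (\<tau> * M ^ Suc m)) * (C * M ^ m')"
      using assms by (intro mult_mono) auto
    then show ?thesis by (simp add: Suc abs_mult power2_eq_square algebra_simps)
  qed
  show ?thesis unfolding mixed_minor_def using 1 2 zero_le_power2[of "esym_on A m x"] by linarith
qed

text \<open>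
  Each mixed term is split by Young's inequality. The parameter \<open>s\<close> weights the pairs with one index in
  \<open>L\<close>, so that they cost only \<open>s\<close> on \<open>L\<close> and \<open>K\<^sup>2 / s\<close> outside.
\<close>
lemma quadratic_form_lower_bound:
  fixes d \<eta> :: "'a \<Rightarrow> real" and N :: "'a \<Rightarrow> 'a \<Rightarrow> real" and c K s \<tau> :: real
  assumes "finite A" "L \<subseteq> A" and d: "\<And>p. p \<in> A \<Longrightarrow> d p \<ge> 0" "\<And>p. p \<in> L \<Longrightarrow> d p \<ge> c"
    and N: "\<And>p q. p \<in> A \<Longrightarrow> q \<in> A \<Longrightarrow> p \<noteq> q \<Longrightarrow> \<bar>N p q\<bar> \<le> K"
    and NL: "\<And>p q. p \<in> L \<Longrightarrow> q \<in> L \<Longrightarrow> p \<noteq> q \<Longrightarrow> \<bar>N p q\<bar> \<le> K * \<tau>"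
    and "s > 0" "0 \<le> K" "0 \<le> \<tau>"
  shows "(c - card A * (K * \<tau> + s)) * (\<Sum>p\<in>L. (\<eta> p)\<^sup>2)
      - card A * (K + K\<^sup>2 / s) * (\<Sum>p\<in>A - L. (\<eta> p)\<^sup>2)
    \<le> (\<Sum>p\<in>A. d p * (\<eta> p)\<^sup>2) + (\<Sum>p\<in>A. \<Sum>q\<in>A - {p}. N p q * (\<eta> p * \<eta> q))"
proof -
  \<comment> \<open>With these weights every mixed term, wherever its indices lie, is at most
      \<open>(w p * (\<eta> p)\<^sup>2 + w q * (\<eta> q)\<^sup>2) / 2\<close>.\<close>
  define w where "w p = (if p \<in> L then K * \<tau> + s else K + K\<^sup>2 / s)" for p
  have w: "w p \<ge> 0" for p using assms by (simp add: w_def)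
  have weighted: "K * (a * b) \<le> (s * a\<^sup>2 + K\<^sup>2 / s * b\<^sup>2) / 2" for a b :: real
  proof -
    have "0 \<le> (s * a - K * b)\<^sup>2 / s" using assms by simp
    also have "\<dots> = s * a\<^sup>2 + K\<^sup>2 / s * b\<^sup>2 - 2 * (K * (a * b))"
      using assms by (simp add: field_simps power2_eq_square)
    finally show ?thesis by simp
  qed
  have amgm: "a * b \<le> (a\<^sup>2 + b\<^sup>2) / 2" for a b :: real
    using sum_squares_bound[of a b] by simp
  have entry: "\<bar>N p q * (\<eta> p * \<eta> q)\<bar> \<le> (w p * (\<eta> p)\<^sup>2 + w q * (\<eta> q)\<^sup>2) / 2"
    if "p \<in> A" "q \<in> A" "p \<noteq> q" for p q
  proof -
    let ?a = "\<bar>\<eta> p\<bar>" and ?b = "\<bar>\<eta> q\<bar>"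
    have le: "\<bar>N p q * (\<eta> p * \<eta> q)\<bar> \<le> B * (?a * ?b)" if "\<bar>N p q\<bar> \<le> B" for B
      using that by (simp add: abs_mult mult_right_mono)
    have nn: "s * ?a\<^sup>2 \<ge> 0" "s * ?b\<^sup>2 \<ge> 0" "K\<^sup>2 / s * ?a\<^sup>2 \<ge> 0" "K\<^sup>2 / s * ?b\<^sup>2 \<ge> 0"
      "K * \<tau> * ?a\<^sup>2 \<ge> 0" "K * \<tau> * ?b\<^sup>2 \<ge> 0" "K * ?a\<^sup>2 \<ge> 0" "K * ?b\<^sup>2 \<ge> 0"
      using assms by simp_all
    consider "p \<in> L" "q \<in> L" | "p \<in> L" "q \<notin> L" | "p \<notin> L" "q \<in> L" | "p \<notin> L" "q \<notin> L" by blast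
    then show ?thesis
    proof cases
      case 1
      have "K * \<tau> * (?a * ?b) \<le> K * \<tau> * ((?a\<^sup>2 + ?b\<^sup>2) / 2)"
        using assms by (intro mult_left_mono amgm) auto
      then show ?thesis using le[OF NL[OF 1 that(3)]] nn 1 by (simp add: w_def algebra_simps)
    next
      case 2
      then show ?thesis using le[OF N[OF that]] weighted[of ?a ?b] nn by (simp add: w_def algebra_simps)
    next
      case 3
      then show ?thesis using le[OF N[OF that]] weighted[of ?b ?a] nn by (simp add: w_def algebra_simps)
    next
      case 4
      have "K * (?a * ?b) \<le> K * ((?a\<^sup>2 + ?b\<^sup>2) / 2)"
        using assms by (intro mult_left_mono amgm) auto
      then show ?thesis using le[OF N[OF that]] nn 4 by (simp add: w_def algebra_simps)
    qed
  qed
  have "- (\<Sum>p\<in>A. \<Sum>q\<in>A - {p}. N p q * (\<eta> p * \<eta> q))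
      \<le> (\<Sum>p\<in>A. \<Sum>q\<in>A - {p}. (w p * (\<eta> p)\<^sup>2 + w q * (\<eta> q)\<^sup>2) / 2)"
    unfolding sum_negf[symmetric] using entry by (intro sum_mono) (force simp: abs_le_iff)
  also have "\<dots> \<le> (\<Sum>p\<in>A. \<Sum>q\<in>A. (w p * (\<eta> p)\<^sup>2 + w q * (\<eta> q)\<^sup>2) / 2)"
    using assms(1) w by (intro sum_mono sum_mono2) auto
  also have "\<dots> = card A * (\<Sum>p\<in>A. w p * (\<eta> p)\<^sup>2)"
    by (simp add: sum.distrib sum_divide_distrib[symmetric] sum_distrib_left[symmetric])
  also have "(\<Sum>p\<in>A. w p * (\<eta> p)\<^sup>2)
      = (K * \<tau> + s) * (\<Sum>p\<in>L. (\<eta> p)\<^sup>2) + (K + K\<^sup>2 / s) * (\<Sum>p\<in>A - L. (\<eta> p)\<^sup>2)"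
    using assms(1,2) by (simp add: sum.subset_diff[of L A] w_def sum_distrib_left)
  finally have off: "- (\<Sum>p\<in>A. \<Sum>q\<in>A - {p}. N p q * (\<eta> p * \<eta> q))
    \<le> card A * ((K * \<tau> + s) * (\<Sum>p\<in>L. (\<eta> p)\<^sup>2) + (K + K\<^sup>2 / s) * (\<Sum>p\<in>A - L. (\<eta> p)\<^sup>2))" .
  have "c * (\<Sum>p\<in>L. (\<eta> p)\<^sup>2) \<le> (\<Sum>p\<in>L. d p * (\<eta> p)\<^sup>2)"
    unfolding sum_distrib_left using d by (intro sum_mono mult_right_mono) auto
  also have "\<dots> \<le> (\<Sum>p\<in>A. d p * (\<eta> p)\<^sup>2)"
    using assms(1,2) d by (intro sum_mono2) auto
  finally show ?thesis using off by (simp add: algebra_simps)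
qed


text \<open>
  With \<open>m + 1\<close> entries comparable to \<open>M\<close> and the others at most \<open>\<tau> M\<close>, the form \<open>- D\<^sup>2 ln\<close> of the
  elementary symmetric function of degree \<open>m + 1\<close> is close to \<open>\<Sum>p\<in>L. (v p / x p)\<^sup>2\<close> as \<open>\<tau>\<close> tends to
  \<open>0\<close>, up to terms in which \<open>v\<close> is evaluated outside \<open>L\<close>; and \<open>1 / x p \<ge> 1 / M\<close>.
\<close>
lemma ln_esym_on_Hessian_lower_bound:
  fixes M \<delta> \<tau> s :: real
  assumes fin: "finite A" and LA: "L \<subseteq> A" and cardL: "card L = Suc m"
    and cone: "in_cone A (Suc (Suc m)) x"
    and "M > 0" "\<delta> > 0" "0 \<le> \<tau>" "\<tau> \<le> 1" "s > 0"
    and x: "\<And>i. i \<in> A \<Longrightarrow> \<bar>x i\<bar> \<le> M" "\<And>i. i \<in> L \<Longrightarrow> \<delta> * M \<le> x i"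
      "\<And>i. i \<in> A - L \<Longrightarrow> \<bar>x i\<bar> \<le> \<tau> * M"
    and K_def: "K = 2 * (2 ^ card A)\<^sup>2 / (\<delta> ^ Suc m)\<^sup>2"
  shows "(1 - 2 * (2 ^ card A * \<tau> / \<delta> ^ Suc m) - card A * (K * \<tau> + s)) * (\<Sum>p\<in>L. (v p / M)\<^sup>2)
      - card A * (K + K\<^sup>2 / s) * (\<Sum>p\<in>A - L. (v p / M)\<^sup>2)
    \<le> (esym_dir A (Suc m) x v / esym_on A (Suc m) x)\<^sup>2 - esym_dir2 A (Suc m) x v / esym_on A (Suc m) x"
proof -
  define C :: real where "C = 2 ^ card A"
  define \<sigma> where "\<sigma> = esym_on A (Suc m) x"
  have C: "C > 0" by (simp add: C_def)
  have finL: "finite L" using fin LA finite_subset by auto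
  have xpos: "x i > 0" if "i \<in> L" for i
    using x(2)[OF that] assms(5,6) mult_pos_pos[of \<delta> M] by linarith
  have "(\<delta> * M) ^ Suc m = (\<Prod>i\<in>L. \<delta> * M)" by (simp add: cardL)
  also have "\<dots> \<le> (\<Prod>i\<in>L. x i)" using x(2) assms(5,6) by (intro prod_mono) auto
  also have "\<dots> \<le> \<sigma>"
    using prod_le_esym_on[OF fin LA] cone xpos cardL by (force simp: \<sigma>_def)
  finally have \<sigma>_ge: "\<delta> ^ Suc m * M ^ Suc m \<le> \<sigma>" by (simp only: power_mult_distrib)
  have \<delta>M: "\<delta> ^ Suc m * M ^ Suc m > 0" using assms by simp
  with \<sigma>_ge have \<sigma>: "\<sigma> > 0" by linarith
  have minor_pos: "esym_on (A - {p}) m x > 0" if "p \<in> A" for p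
    using in_cone_remove[OF fin cone that] by (simp add: in_coneD)
  define d where "d p = (esym_on (A - {p}) m x * M / \<sigma>)\<^sup>2" for p
  define N where "N p q = mixed_minor (A - {p} - {q}) m x * M\<^sup>2 / \<sigma>\<^sup>2" for p q
  \<comment> \<open>\<open>x p * esym_on (A - {p}) m x\<close> differs from \<open>\<sigma>\<close> by \<open>esym_on (A - {p}) (Suc m) x\<close>, all of whose
      monomials contain a small entry.\<close>
  have d_L: "1 - 2 * (C * \<tau> / \<delta> ^ Suc m) \<le> d p" if p: "p \<in> L" for p
  proof -
    have pA: "p \<in> A" using p LA by auto
    have "\<bar>esym_on (A - {p}) (Suc m) x\<bar> \<le> C * (\<tau> * M ^ Suc m)"
      unfolding C_def
    proof (rule abs_esym_on_le_small[where L = L])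
      have "(A - {p}) \<inter> L = L - {p}" using LA by auto
      then show "card ((A - {p}) \<inter> L) < Suc m" using p cardL finL by (simp add: card_Diff_singleton)
    qed (use fin x assms(5-7) in \<open>auto intro: card_mono\<close>)
    also have "\<dots> \<le> C * \<tau> / \<delta> ^ Suc m * \<sigma>"
      using \<sigma>_ge assms(6,7) C mult_left_mono[OF \<sigma>_ge, of "C * \<tau>"] by (simp add: field_simps)
    finally have "\<sigma> - C * \<tau> / \<delta> ^ Suc m * \<sigma> \<le> x p * esym_on (A - {p}) m x"
      using esym_on_remove[OF fin pA, of m x] by (simp add: \<sigma>_def abs_le_iff)
    also have "\<dots> \<le> M * esym_on (A - {p}) m x"
      using x(1)[OF pA] minor_pos[OF pA] by (intro mult_right_mono) auto
    finally have "(1 - C * \<tau> / \<delta> ^ Suc m) * \<sigma> \<le> esym_on (A - {p}) m x * M"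
      by (simp only: left_diff_distrib mult_1 mult.commute[of M])
    then have 1: "1 - C * \<tau> / \<delta> ^ Suc m \<le> esym_on (A - {p}) m x * M / \<sigma>"
      using \<sigma> by (simp only: pos_le_divide_eq)
    have sq: "1 - 2 * a \<le> b\<^sup>2" if "1 - a \<le> b" for a b :: real
      using that zero_le_power2[of "b - 1"] by (simp add: power2_eq_square algebra_simps)
    show ?thesis unfolding d_def by (rule sq[OF 1])
  qed
  \<comment> \<open>Used with \<open>t = \<tau>\<close> for two indices in \<open>L\<close> and with \<open>t = 1\<close> otherwise.\<close>
  have minor: "\<bar>N p q\<bar> \<le> K * t"
    if "p \<in> A" "q \<in> A" "0 \<le> t" "t \<le> 1"
      and small: "\<And>j. j \<in> {m, Suc m} \<Longrightarrow> \<bar>esym_on (A - {p} - {q}) j x\<bar> \<le> C * (t * M ^ j)" for p q t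
  proof -
    have "\<bar>esym_on (A - {p} - {q}) j x\<bar> \<le> C * M ^ j" for j
      unfolding C_def using fin x assms(5) by (intro abs_esym_on_le_power) (auto intro: card_mono)
    then have "\<bar>mixed_minor (A - {p} - {q}) m x\<bar> \<le> 2 * C\<^sup>2 * t * (M ^ m)\<^sup>2"
      using small[of m] small[of "Suc m"] assms(5) C \<open>0 \<le> t\<close> \<open>t \<le> 1\<close>
      by (intro abs_mixed_minor_le) simp_all
    then have "\<bar>mixed_minor (A - {p} - {q}) m x\<bar> * M\<^sup>2 \<le> 2 * C\<^sup>2 * t * (M ^ m)\<^sup>2 * M\<^sup>2"
      by (intro mult_right_mono) auto
    also have "\<dots> = K * t * (\<delta> ^ Suc m * M ^ Suc m)\<^sup>2"
      using assms(6) by (simp add: K_def C_def power_mult_distrib)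
    also have "\<dots> \<le> K * t * \<sigma>\<^sup>2"
      using \<sigma>_ge \<delta>M \<open>0 \<le> t\<close> by (intro mult_left_mono power_mono) (auto simp: K_def)
    finally show ?thesis using \<sigma> by (simp add: N_def abs_mult divide_le_eq)
  qed
  have N_L: "\<bar>N p q\<bar> \<le> K * \<tau>" if pq: "p \<in> L" "q \<in> L" "p \<noteq> q" for p q
  proof (rule minor)
    have "(A - {p} - {q}) \<inter> L = L - {p} - {q}" using LA by auto
    moreover have "card L \<ge> 2" using card_mono[OF finL, of "{p, q}"] pq by simp
    ultimately have card: "card ((A - {p} - {q}) \<inter> L) < m"
      using pq cardL finL by (simp add: card_Diff_singleton)
    fix j assume j: "j \<in> {m, Suc m}"
    show "\<bar>esym_on (A - {p} - {q}) j x\<bar> \<le> C * (\<tau> * M ^ j)"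
      unfolding C_def
    proof (rule abs_esym_on_le_small[where L = L])
      show "card ((A - {p} - {q}) \<inter> L) < j" using card j by auto
    qed (use fin x assms(5-7) in \<open>auto intro: card_mono\<close>)
  qed (use pq LA assms in auto)
  have N_A: "\<bar>N p q\<bar> \<le> K" if pq: "p \<in> A" "q \<in> A" "p \<noteq> q" for p q
  proof -
    have "\<bar>N p q\<bar> \<le> K * 1"
    proof (rule minor)
      show "\<bar>esym_on (A - {p} - {q}) j x\<bar> \<le> C * (1 * M ^ j)" for j
        unfolding C_def mult_1
        using fin x assms(5) by (intro abs_esym_on_le_power) (auto intro: card_mono)
    qed (use pq in auto)
    then show ?thesis by simp
  qed
  have "(1 - 2 * (C * \<tau> / \<delta> ^ Suc m) - card A * (K * \<tau> + s)) * (\<Sum>p\<in>L. (v p / M)\<^sup>2)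
      - card A * (K + K\<^sup>2 / s) * (\<Sum>p\<in>A - L. (v p / M)\<^sup>2)
    \<le> (\<Sum>p\<in>A. d p * (v p / M)\<^sup>2) + (\<Sum>p\<in>A. \<Sum>q\<in>A - {p}. N p q * (v p / M * (v q / M)))"
    using fin LA d_L N_A N_L assms(7,9)
    by (intro quadratic_form_lower_bound) (auto simp: d_def K_def)
  also have "\<dots> = ((\<Sum>p\<in>A. (esym_on (A - {p}) m x)\<^sup>2 * (v p)\<^sup>2)
      + (\<Sum>p\<in>A. \<Sum>q\<in>A - {p}. mixed_minor (A - {p} - {q}) m x * (v p * v q))) / \<sigma>\<^sup>2"
    using assms(5) by (simp add: add_divide_distrib sum_divide_distrib d_def N_def power_divide
        power_mult_distrib) (simp add: power2_eq_square)
  also have "\<dots> = ((esym_dir A (Suc m) x v)\<^sup>2 - \<sigma> * esym_dir2 A (Suc m) x v) / \<sigma>\<^sup>2"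
    unfolding ln_esym_on_Hessian_form[OF fin, symmetric] \<sigma>_def ..
  also have "\<dots> = (esym_dir A (Suc m) x v / \<sigma>)\<^sup>2 - esym_dir2 A (Suc m) x v / \<sigma>"
    using \<sigma> by (simp add: diff_divide_distrib power_divide power2_eq_square)
  finally show ?thesis by (simp only: C_def \<sigma>_def)
qed


section \<open>Partial derivatives\<close>

lemma pderivative_esym_on:
  assumes "finite A" "i \<in> A"
  shows "pderivative i (esym_on A (Suc j)) = esym_on (A - {i}) j"
proof
  fix x
  have "(\<lambda>t. esym_on A (Suc j) (x(i := t)))
      = (\<lambda>t. t * esym_on (A - {i}) j x + esym_on (A - {i}) (Suc j) x)"
    using assms by (simp add: esym_on_remove[of A i] esym_on_fun_upd)
  moreover have "((\<lambda>t. t * esym_on (A - {i}) j x + esym_on (A - {i}) (Suc j) x)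
      has_field_derivative esym_on (A - {i}) j x) (at (x i))"
    by (auto intro!: derivative_eq_intros)
  ultimately show "pderivative i (esym_on A (Suc j)) x = esym_on (A - {i}) j x"
    unfolding pderivative_def by (metis DERIV_imp_deriv)
qed

lemma esym_d1_eq: "i \<in> {1..n} \<Longrightarrow> esym_d1 n (Suc k) i = esym_on ({1..n} - {i}) k"
  by (simp add: esym_d1_def esym_eq_esym_on pderivative_esym_on)

lemma esym_d2_eq:
  "p \<in> {1..n} \<Longrightarrow> q \<in> {1..n} \<Longrightarrow> p \<noteq> q \<Longrightarrow>
    esym_d2 n (Suc (Suc k)) p q = esym_on ({1..n} - {p} - {q}) k"
  by (simp add: esym_d2_def esym_eq_esym_on pderivative_esym_on Diff_insert2[symmetric] insert_commute)

lemma sum_esym_d1_eq: "(\<Sum>i = 1..n. esym_d1 n (Suc k) i x * v i) = esym_dir {1..n} (Suc k) x v"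
  unfolding esym_dir.simps by (intro sum.cong refl) (simp add: esym_d1_eq)

lemma sum_esym_d2_eq:
  "(\<Sum>(p, q)\<in>{(p, q). p \<in> {1..n} \<and> q \<in> {1..n} \<and> p \<noteq> q}. esym_d2 n (Suc (Suc k)) p q x * v p * v q / c)
    = esym_dir2 {1..n} (Suc (Suc k)) x v / c"
proof -
  have "{(p, q). p \<in> {1..n} \<and> q \<in> {1..n} \<and> p \<noteq> q} = Sigma {1..n} (\<lambda>p. {1..n} - {p})"
    by auto
  then have "(\<Sum>(p, q)\<in>{(p, q). p \<in> {1..n} \<and> q \<in> {1..n} \<and> p \<noteq> q}.
      esym_d2 n (Suc (Suc k)) p q x * v p * v q / c)
    = (\<Sum>p\<in>{1..n}. \<Sum>q\<in>{1..n} - {p}. esym_d2 n (Suc (Suc k)) p q x * v p * v q / c)"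
    by (simp add: sum.Sigma)
  also have "\<dots> = (\<Sum>p\<in>{1..n}. \<Sum>q\<in>{1..n} - {p}. esym_on ({1..n} - {p} - {q}) k x * v p * v q / c)"
    by (intro sum.cong refl) (subst esym_d2_eq, auto)
  finally show ?thesis
    by (simp add: sum_distrib_left sum_divide_distrib mult_ac)
qed

section \<open>The small entries of a point of the Garding cone\<close>

lemma garding_cone_iff: "x \<in> garding_cone n k \<longleftrightarrow> in_cone {1..n} k x"
  unfolding garding_cone_def in_cone_def esym_eq_esym_on
  by (auto simp: Suc_le_eq)

text \<open>
  Deleting the \<open>l\<close> largest entries leaves a point of the cone of order \<open>1\<close>, so the remaining entries
  have a positive sum. Hence the largest of them is positive and controls the negative ones.
\<close>
lemma tail_bounds:
  fixes x :: "nat \<Rightarrow> real" and n k l :: nat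
  assumes cone: "in_cone {1..n} k x" and lk: "l < k" "k \<le> n"
    and mono: "\<forall>i j. 1 \<le> i \<and> i \<le> j \<and> j \<le> n \<longrightarrow> x j \<le> x i"
  shows "x (l + 1) > 0"
    and "\<And>i. i \<in> {1..n} - {1..l} \<Longrightarrow> \<bar>x i\<bar> \<le> n * x (l + 1)"
proof -
  let ?T = "{1..n} - {1..l}"
  have le: "x i \<le> x (l + 1)" if "i \<in> ?T" for i using mono that by auto
  have "in_cone {1..n} (card {1..l} + 1) x" using cone lk by (auto intro: in_cone_mono)
  then have "in_cone ?T 1 x" using lk by (intro in_cone_remove_subset) auto
  then have sum: "sum x ?T > 0" by (auto dest: in_coneD[of _ _ _ 1] simp: esym_on_1)
  also have "sum x ?T \<le> card ?T * x (l + 1)" using le by (intro sum_bounded_above) auto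
  finally show pos: "x (l + 1) > 0" by (simp add: zero_less_mult_iff)
  fix i assume i: "i \<in> ?T"
  have "0 < x i + sum x (?T - {i})" using sum i by (simp add: sum.remove)
  also have "sum x (?T - {i}) \<le> card (?T - {i}) * x (l + 1)"
    using le by (intro sum_bounded_above) auto
  also have "\<dots> \<le> n * x (l + 1)"
    using pos card_mono[of "{1..n}" "?T - {i}"] by (intro mult_right_mono) auto
  finally have "- x i \<le> n * x (l + 1)" by simp
  moreover have "1 * x (l + 1) \<le> n * x (l + 1)" using pos lk by (intro mult_right_mono) auto
  ultimately show "\<bar>x i\<bar> \<le> n * x (l + 1)" using le[OF i] by (simp add: abs_le_iff)
qed

text \<open>
  \<open>esym_on_le_sum_mult_remove\<close> for a set \<open>B\<close> of \<open>k\<close> indices that contains \<open>1, \<dots>, l\<close> but not \<open>q\<close>.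
\<close>
lemma esym_le_tail_mult_minor:
  fixes x :: "nat \<Rightarrow> real" and n k l :: nat
  assumes cone: "in_cone {1..n} (Suc k) x" and lk: "l \<le> k" "k < n"
    and mono: "\<forall>i j. 1 \<le> i \<and> i \<le> j \<and> j \<le> n \<longrightarrow> x j \<le> x i"
    and q: "q \<in> {1..n} - {1..l}"
  shows "esym_on {1..n} (Suc k) x \<le> n * x (l + 1) * esym_on ({1..n} - {q}) k x"
proof -
  have "{1..l} \<subseteq> {1..n} - {q}" "card {1..l} \<le> k" "k \<le> card ({1..n} - {q})"
    using lk q by (auto simp: card_Diff_singleton)
  then obtain B where B: "{1..l} \<subseteq> B" "B \<subseteq> {1..n} - {q}" "card B = k"
    using exists_subset_between[of "{1..l}" k "{1..n} - {q}"] by blast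
  have pos: "x (l + 1) > 0" using tail_bounds(1)[OF cone _ _ mono] lk by auto
  have "x i \<le> x (l + 1)" if "i \<in> {1..n} - B" for i
  proof -
    have "i \<notin> {1..l}" using B(1) that by blast
    then show ?thesis using mono that by auto
  qed
  then have "sum x ({1..n} - B) \<le> card ({1..n} - B) * x (l + 1)"
    by (intro sum_bounded_above) auto
  also have "\<dots> \<le> n * x (l + 1)"
    using pos card_mono[of "{1..n}" "{1..n} - B"] by (intro mult_right_mono) auto
  finally have sum: "sum x ({1..n} - B) \<le> n * x (l + 1)" .
  have "esym_on {1..n} (Suc k) x \<le> sum x ({1..n} - B) * esym_on ({1..n} - {q}) k x"
    using esym_on_le_sum_mult_remove[of "{1..n}" q B x] B q cone by auto
  also have "\<dots> \<le> n * x (l + 1) * esym_on ({1..n} - {q}) k x"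
    using sum in_cone_remove[OF _ cone, of q] q by (intro mult_right_mono) (auto dest: in_coneD)
  finally show ?thesis .
qed


section \<open>The concavity inequality\<close>

theorem lemma3p1:
  fixes n k l :: nat and \<epsilon> \<delta> \<delta>\<^sub>0 :: real
  assumes "1 \<le> l" and "l < k" and "k \<le> n"
    and "0 < \<epsilon>" and "\<epsilon> < 1"
    and "0 < \<delta>" and "\<delta> < 1"
    and "0 < \<delta>\<^sub>0" and "\<delta>\<^sub>0 < 1"
  shows "\<exists>\<delta>'>0. \<forall>x :: nat \<Rightarrow> real.
    x \<in> garding_cone n k \<longrightarrow>
    (\<forall>i j. 1 \<le> i \<and> i \<le> j \<and> j \<le> n \<longrightarrow> x j \<le> x i) \<longrightarrow>
    x l \<ge> \<delta> * x 1 \<longrightarrow>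
    x (l + 1) \<le> \<delta>' * x 1 \<longrightarrow>
    (\<forall>\<xi> :: nat \<Rightarrow> real.
      - (\<Sum>(p, q)\<in>{(p, q). p \<in> {1..n} \<and> q \<in> {1..n} \<and> p \<noteq> q}.
            esym_d2 n k p q x * \<xi> p * \<xi> q / esym n k x)
        + (\<Sum>i = 1..n. esym_d1 n k i x * \<xi> i)\<^sup>2 / (esym n k x)\<^sup>2
      \<ge> (1 - \<epsilon>) * ((\<xi> 1)\<^sup>2 / (x 1)\<^sup>2)
        - \<delta>\<^sub>0 * (\<Sum>i = l + 1..n. esym_d1 n k i x * (\<xi> i)\<^sup>2 / (x 1 * esym n k x)))"
proof -
  obtain m where m: "l = Suc m" using \<open>1 \<le> l\<close> by (cases l) auto
  have "2 \<le> k" using \<open>1 \<le> l\<close> \<open>l < k\<close> by simp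
  then obtain k' where "k = 2 + k'" using le_Suc_ex by blast
  then have k': "k = Suc (Suc k')" by simp
  let ?A = "{1..n}" and ?L = "{1..l}"
  \<comment> \<open>The loss in the coefficient of \<open>\<xi>\<^sub>1\<^sup>2 / \<lambda>\<^sub>1\<^sup>2\<close> is \<open>C\<^sub>1 * \<delta>' + n * s\<close>, of which \<open>n * s\<close> is \<open>\<epsilon> / 4\<close>;
      \<open>C\<^sub>2\<close> is the coefficient of the tail. The bound on the small entries is \<open>\<tau> = n * \<delta>'\<close>.\<close>
  define K :: real where "K = 2 * (2 ^ n)\<^sup>2 / (\<delta> ^ Suc m)\<^sup>2"
  define s where "s = \<epsilon> / (4 * n)"
  define C\<^sub>1 where "C\<^sub>1 = 2 * 2 ^ n * n / \<delta> ^ Suc m + n * K * n"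
  define C\<^sub>2 where "C\<^sub>2 = n * (K + K\<^sup>2 / s)"
  define \<delta>' where "\<delta>' = min (1 / n) (min (\<epsilon> / (2 * C\<^sub>1)) (\<delta>\<^sub>0 / (n * C\<^sub>2)))"
  have n: "n > 0" using assms by simp
  have K: "K > 0" using assms by (simp add: K_def)
  have s: "s > 0" using assms n by (simp add: s_def)
  have C: "C\<^sub>1 > 0" "C\<^sub>2 > 0" using assms n K s by (auto simp: C\<^sub>1_def C\<^sub>2_def intro!: add_pos_pos mult_pos_pos)
  have \<delta>': "\<delta>' > 0" using assms n C by (simp add: \<delta>'_def)
  have "\<delta>' \<le> 1 / n" "\<delta>' \<le> \<epsilon> / (2 * C\<^sub>1)" "\<delta>' \<le> \<delta>\<^sub>0 / (n * C\<^sub>2)"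
    by (simp_all add: \<delta>'_def)
  then have \<delta>'_le: "n * \<delta>' \<le> 1" "C\<^sub>1 * \<delta>' \<le> \<epsilon> / 2" "C\<^sub>2 * (n * \<delta>') \<le> \<delta>\<^sub>0"
    using n C by (simp_all add: field_simps)
  show ?thesis
  proof (intro exI[of _ \<delta>'] conjI allI impI \<delta>')
    fix x \<xi> :: "nat \<Rightarrow> real"
    assume "x \<in> garding_cone n k" and mono: "\<forall>i j. 1 \<le> i \<and> i \<le> j \<and> j \<le> n \<longrightarrow> x j \<le> x i"
      and big: "x l \<ge> \<delta> * x 1" and small: "x (l + 1) \<le> \<delta>' * x 1"
    then have cone: "in_cone ?A k x" by (simp add: garding_cone_iff)
    note tail = tail_bounds[OF cone assms(2,3) mono]
    have "x 1 \<ge> x (l + 1)" using mono assms(2,3) by simp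
    with tail(1) have M: "x 1 > 0" by linarith
    have "n * x (l + 1) \<le> n * (\<delta>' * x 1)" using small by (intro mult_left_mono) auto
    then have tail_le: "n * x (l + 1) \<le> n * \<delta>' * x 1" by simp
    have \<sigma>: "esym_on ?A k x > 0" using cone by (simp add: in_coneD)
    have "n * \<delta>' * x 1 \<le> 1 * x 1" using \<delta>'_le(1) M by (intro mult_right_mono) auto
    then have tail_le': "n * x (l + 1) \<le> x 1" using tail_le by linarith
    have x_L: "\<delta> * x 1 \<le> x i" if "i \<in> ?L" for i
    proof -
      have "x l \<le> x i" using mono that assms(2,3) by auto
      then show ?thesis using big by linarith
    qed
    have x_A: "\<bar>x i\<bar> \<le> x 1" if "i \<in> ?A" for i
    proof (cases "i \<in> ?L")
      case True
      have "x i \<le> x 1" using mono that by auto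
      moreover have "0 < x i" using x_L[OF True] mult_pos_pos[OF \<open>0 < \<delta>\<close> M] by linarith
      ultimately show ?thesis by simp
    next
      case False
      then show ?thesis using tail(2)[of i] that tail_le' by force
    qed
    have x_T: "\<bar>x i\<bar> \<le> n * \<delta>' * x 1" if "i \<in> ?A - ?L" for i
      using tail(2)[OF that] tail_le by linarith
    define U where "U = (\<Sum>p\<in>?L. (\<xi> p / x 1)\<^sup>2)"
    define V where "V = (\<Sum>p\<in>?A - ?L. (\<xi> p / x 1)\<^sup>2)"
    have "(1 - 2 * (2 ^ card ?A * (n * \<delta>') / \<delta> ^ Suc m) - card ?A * (K * (n * \<delta>') + s)) * U
        - card ?A * (K + K\<^sup>2 / s) * V
      \<le> (esym_dir ?A l x \<xi> / esym_on ?A l x)\<^sup>2 - esym_dir2 ?A l x \<xi> / esym_on ?A l x"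
      unfolding U_def V_def m
    proof (rule ln_esym_on_Hessian_lower_bound)
      show "in_cone ?A (Suc (Suc m)) x" using cone assms(2) by (auto simp: m intro: in_cone_mono)
      show "K = 2 * (2 ^ card ?A)\<^sup>2 / (\<delta> ^ Suc m)\<^sup>2" by (simp add: K_def)
    qed (use assms M n s \<delta>' \<delta>'_le x_L x_A x_T in \<open>auto simp: m\<close>)
    also have "\<dots> \<le> (esym_dir ?A k x \<xi> / esym_on ?A k x)\<^sup>2 - esym_dir2 ?A k x \<xi> / esym_on ?A k x"
      using assms(2) cone by (intro ln_esym_on_Hessian_mono) auto
    finally have lower: "(1 - C\<^sub>1 * \<delta>' - n * s) * U - C\<^sub>2 * V
      \<le> (esym_dir ?A k x \<xi> / esym_on ?A k x)\<^sup>2 - esym_dir2 ?A k x \<xi> / esym_on ?A k x"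
      by (simp add: C\<^sub>1_def C\<^sub>2_def algebra_simps)
    have U: "(\<xi> 1 / x 1)\<^sup>2 \<le> U"
      unfolding U_def using assms(1) by (intro member_le_sum) auto
    have "n * s = \<epsilon> / 4" using n by (simp add: s_def)
    then have "(1 - \<epsilon>) * U \<le> (1 - C\<^sub>1 * \<delta>' - n * s) * U"
      using \<delta>'_le(2) assms order_trans[OF zero_le_power2 U] by (intro mult_right_mono) auto
    moreover have "(1 - \<epsilon>) * (\<xi> 1 / x 1)\<^sup>2 \<le> (1 - \<epsilon>) * U"
      using U assms by (intro mult_left_mono) auto
    moreover have "C\<^sub>2 * V \<le> \<delta>\<^sub>0 * (\<Sum>i\<in>?A - ?L. esym_on (?A - {i}) (Suc k') x * (\<xi> i)\<^sup>2 / (x 1 * esym_on ?A k x))"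
      unfolding V_def sum_distrib_left
    proof (rule sum_mono)
      fix q assume q: "q \<in> ?A - ?L"
      let ?\<sigma>q = "esym_on (?A - {q}) (Suc k') x"
      have pos: "?\<sigma>q > 0" using in_cone_remove[of ?A "Suc k'" x q] cone q by (auto simp: k' dest: in_coneD)
      have "esym_on ?A k x \<le> n * x (l + 1) * ?\<sigma>q"
        unfolding k' using assms(2,3) cone q mono by (intro esym_le_tail_mult_minor) (auto simp: k')
      also have "\<dots> \<le> n * \<delta>' * x 1 * ?\<sigma>q" using tail_le pos by (intro mult_right_mono) auto
      finally have "C\<^sub>2 * esym_on ?A k x \<le> C\<^sub>2 * (n * \<delta>' * x 1 * ?\<sigma>q)"
        using C by (intro mult_left_mono) auto
      also have "\<dots> = C\<^sub>2 * (n * \<delta>') * (x 1 * ?\<sigma>q)" by simp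
      also have "\<dots> \<le> \<delta>\<^sub>0 * (x 1 * ?\<sigma>q)" using \<delta>'_le(3) M pos by (intro mult_right_mono) auto
      finally have "C\<^sub>2 \<le> \<delta>\<^sub>0 * (x 1 * ?\<sigma>q) / esym_on ?A k x" using \<sigma> by (simp add: pos_le_divide_eq)
      then have "C\<^sub>2 * (\<xi> q / x 1)\<^sup>2 \<le> \<delta>\<^sub>0 * (x 1 * ?\<sigma>q) / esym_on ?A k x * (\<xi> q / x 1)\<^sup>2"
        by (rule mult_right_mono) simp
      also have "\<dots> = \<delta>\<^sub>0 * (?\<sigma>q * (\<xi> q)\<^sup>2 / (x 1 * esym_on ?A k x))"
        using M by (simp add: power2_eq_square field_simps)
      finally show "C\<^sub>2 * (\<xi> q / x 1)\<^sup>2 \<le> \<delta>\<^sub>0 * (?\<sigma>q * (\<xi> q)\<^sup>2 / (x 1 * esym_on ?A k x))" .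
    qed
    moreover have "(\<Sum>i\<in>?A - ?L. esym_on (?A - {i}) (Suc k') x * (\<xi> i)\<^sup>2 / (x 1 * esym_on ?A k x))
      = (\<Sum>i = l + 1..n. esym_d1 n k i x * (\<xi> i)\<^sup>2 / (x 1 * esym n k x))"
      unfolding k' esym_eq_esym_on by (intro sum.cong) (auto simp: esym_d1_eq)
    ultimately show "(1 - \<epsilon>) * ((\<xi> 1)\<^sup>2 / (x 1)\<^sup>2)
        - \<delta>\<^sub>0 * (\<Sum>i = l + 1..n. esym_d1 n k i x * (\<xi> i)\<^sup>2 / (x 1 * esym n k x))
      \<le> - (\<Sum>(p, q)\<in>{(p, q). p \<in> ?A \<and> q \<in> ?A \<and> p \<noteq> q}.
            esym_d2 n k p q x * \<xi> p * \<xi> q / esym n k x)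
        + (\<Sum>i = 1..n. esym_d1 n k i x * \<xi> i)\<^sup>2 / (esym n k x)\<^sup>2"
      using lower unfolding k' sum_esym_d1_eq sum_esym_d2_eq
      by (simp add: power_divide esym_eq_esym_on del: esym_dir.simps esym_dir2.simps)
  qed
qed

end
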